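(* Let $p\in[2,\infty]$, $D>0$, $B>0$. There exists an absolute constant $c_0>0$ (one can take $c_0=\frac{1}{12\sqrt{58}}$) such that, for every $r\in\mathbb{N}$ and every $T\ge\frac14\cdot\frac{d^2}{2^r\wedge d}$, \[ \sup_{\mathcal{X}\in\mathbb{X}_p(D)}\mathcal{E}^*(\mathcal{X},\mathcal{O}_{\mathtt{c},p},T,\mathcal{W}_{\mathtt{com},r})\ \ge\ \left(\frac{c_0DB\,d^{1/2-1/p}}{\sqrt T}\sqrt{\frac{d}{d\wedge 2^r}}\right)\vee\left(\frac{c_0DB}{\sqrt T}\sqrt{\frac{d}{d\wedge r}}\right). \]
   Context: Setting (first-order optimization under information constraints). Fix $d\ge1$, $\mathcal{X}\subseteq\mathbb{R}^d$, and a set $\mathcal{W}$ of channels with input space $\mathbb{R}^d$. An algorithm with $T$ queries interacts with an oracle $O$ for $f:\mathcal{X}\to\mathbb{R}$: at step $t$ it queries $x_t\in\mathcal{X}$; the oracle returns a random $\hat g(x_t)$ with $\mathbb{E}[\hat g(x_t)\mid x_t]\in\partial f(x_t)$; $\hat g(x_t)$ is passed through a channel $W_t\in\mathcal{W}$ and the algorithm observes only the output $Y_t$; $x_{t+1}$ (and the final output $x_T$) is a possibly randomized function of $Y_1,\dots,Y_t$. Adaptive channel selection: $W_t$ is a function of $Y_1,\dots,Y_{t-1}$. $\mathcal{E}^*(\mathcal{X},\mathcal{O},T,\mathcal{W})=\inf_{\pi}\inf_{S\text{ adaptive}}\sup_{(f,O)\in\mathcal{O}}\mathbb{E}[f(x_T)-\min_{x\in\mathcal{X}}f(x)]$.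 For $p\in[1,\infty]$ with $q=p/(p-1)$, $\mathcal{O}_{\mathtt{c},p}$ is the set of pairs $(f,O)$ with $f$ convex on $\mathcal{X}$, $\mathbb{E}[\hat g(x)\mid x]\in\partial f(x)$ and $\Pr(\|\hat g(x)\|_q^2\le B^2\mid x)=1$ for all $x$. $\mathbb{X}_p(D)=\{\mathcal{X}\subseteq\mathbb{R}^d:\max_{x,y\in\mathcal{X}}\|x-y\|_p\le D\}$. $\mathcal{W}_{\mathtt{com},r}$ is the set of all channels $W:\mathbb{R}^d\to\{0,1\}^r$. $a\wedge b=\min\{a,b\}$, $a\vee b=\max\{a,b\}$. *)

theory Defs
  imports "HOL-Probability.Probability"
begin

definition inv_exp :: "ereal \<Rightarrow> real" where
  "inv_exp p = (if p = \<infinity> then 0 else 1 / real_of_ereal p)"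

definition conj_exp :: "ereal \<Rightarrow> ereal" where
  "conj_exp p = (if p = \<infinity> then 1 else if p = 1 then \<infinity>
                 else ereal (real_of_ereal p / (real_of_ereal p - 1)))"

definition lpnorm :: "ereal \<Rightarrow> real^'n \<Rightarrow> real" where
  "lpnorm p x = (if p = \<infinity> then Max (range (\<lambda>i. \<bar>x $ i\<bar>))
                 else (\<Sum>i\<in>UNIV. \<bar>x $ i\<bar> powr real_of_ereal p) powr (1 / real_of_ereal p))"

definition diam_sets :: "ereal \<Rightarrow> real \<Rightarrow> (real^'n) set set" where
  "diam_sets p D = {X. X \<noteq> {} \<and> (\<forall>x\<in>X. \<forall>y\<in>X. lpnorm p (x - y) \<le> D)}"

definition subdiff :: "(real^'n \<Rightarrow> real) \<Rightarrow> (real^'n) set \<Rightarrow> real^'n \<Rightarrow> (real^'n) set" where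
  "subdiff f X x = {g. \<forall>y\<in>X. f y \<ge> f x + g \<bullet> (y - x)}"

definition oracle_class :: "(real^'n) set \<Rightarrow> ereal \<Rightarrow> real
    \<Rightarrow> ((real^'n \<Rightarrow> real) \<times> (real^'n \<Rightarrow> (real^'n) measure)) set" where
  "oracle_class X p B = {(f, Orc).
      convex_on X f \<and>
      Orc \<in> borel \<rightarrow>\<^sub>M prob_algebra borel \<and>
      (\<forall>x\<in>X. (AE g in Orc x. (lpnorm (conj_exp p) g)\<^sup>2 \<le> B\<^sup>2) \<and>
              (\<integral>g. g \<partial>Orc x) \<in> subdiff f X x)}"

definition com_channels :: "nat \<Rightarrow> (real^'n \<Rightarrow> bool list pmf) set" where
  "com_channels r = {W. (\<forall>g. set_pmf (W g) \<subseteq> {y. length y = r}) \<and>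
                         (\<forall>y. (\<lambda>g. pmf (W g) y) \<in> borel_measurable borel)}"

text \<open>A (randomized) algorithm is a probability distribution M over deterministic policies
  phi; phi maps a history (Y_1,...,Y_t) (chronological list) to the next query point
  x_{t+1} \<in> X; on histories of length T it gives the final output.  Adaptive channel
  selection S maps the history (Y_1,...,Y_{t-1}) to the channel W_t.\<close>
definition valid_alg :: "(real^'n) set \<Rightarrow> (bool list list \<Rightarrow> real^'n) measure \<Rightarrow> bool" where
  "valid_alg X M \<longleftrightarrow> prob_space M \<and> sets M = sets (\<Pi>\<^sub>M h\<in>UNIV. restrict_space borel X)"

definition hist_prob :: "(real^'n \<Rightarrow> (real^'n) measure) \<Rightarrow> (bool list list \<Rightarrow> (real^'n \<Rightarrow> bool list pmf))
    \<Rightarrow> (bool list list \<Rightarrow> real^'n) \<Rightarrow> bool list list \<Rightarrow> real" where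
  "hist_prob Orc S \<phi> h =
     (\<Prod>i<length h. \<integral>g. pmf (S (take i h) g) (h ! i) \<partial>Orc (\<phi> (take i h)))"

definition det_err :: "(real^'n \<Rightarrow> real) \<Rightarrow> (real^'n \<Rightarrow> (real^'n) measure)
    \<Rightarrow> (bool list list \<Rightarrow> (real^'n \<Rightarrow> bool list pmf)) \<Rightarrow> (bool list list \<Rightarrow> real^'n)
    \<Rightarrow> (real^'n) set \<Rightarrow> nat \<Rightarrow> nat \<Rightarrow> real" where
  "det_err f Orc S \<phi> X T r =
     (\<Sum>h\<in>{h. length h = T \<and> (\<forall>y\<in>set h. length y = r)}.
        hist_prob Orc S \<phi> h * (f (\<phi> h) - Inf (f ` X)))"

definition minimax_err :: "(real^'n) set \<Rightarrow> ereal \<Rightarrow> real \<Rightarrow> nat \<Rightarrow> nat \<Rightarrow> ereal" where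
  "minimax_err X p B T r =
     (INF MS \<in> {(M, S). valid_alg X M \<and> (\<forall>h. S h \<in> com_channels r)}.
        SUP fO \<in> oracle_class X p B.
          ereal (\<integral>\<phi>. det_err (fst fO) (snd fO) (snd MS) \<phi> X T r \<partial>(fst MS)))"

end

theory Submission
  imports Defs
begin

text \<open>
  All hard instances are linear functions \<open>f v x = \<mu> v \<bullet> x\<close> on a cube, indexed by sign vectors \<open>v\<close>,
  with an oracle whose answer does not depend on the query.  The law of the transcript is then
  independent of the algorithm, which only enters through its final output.  The regret decouples over
  the coordinates, so by Assouad's method it is large as long as the sum over \<open>i\<close> of the total
  variation distances between the transcripts under \<open>v\<close> and under \<open>v\<close> with sign \<open>i\<close> flipped is at
  most \<open>d / 2\<close>.  By the chain rule for the Kullback-Leibler divergence it is enough to bound, for one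
  channel, the sum over \<open>i\<close> of the chi-square divergences of the messages.

  For the first bound the oracle returns \<open>\<plusminus> B\<close> times a uniformly chosen unit vector, with bias
  \<open>\<delta> v i\<close> in the sign; the sum is of order \<open>\<delta>\<^sup>2 min (2 ^ r) d / d\<close>.  For the second bound it returns
  independent signs of bias \<open>\<delta> v i\<close> in all coordinates, scaled to \<open>q\<close>-norm \<open>B\<close>; by the level-1
  inequality the sum is at most of order \<open>\<delta>\<^sup>2\<close> times the entropy of the message, which is at most
  \<open>r\<close> bits.
\<close>

section \<open>Divergence of transcripts\<close>

text \<open>A pointwise substitute for Pinsker's inequality, passing through the squared Hellinger
  term. It is affine in the divergence: summed over two probability vectors it reads "L1 distance at
  most 2 KL + 1/2", with no square root, so bounds for different neighbours can simply be
  added.\<close>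

lemma abs_diff_le_kl:
  fixes a b :: real
  assumes "0 \<le> a" "0 \<le> b" "b = 0 \<Longrightarrow> a = 0"
  shows "\<bar>a - b\<bar> \<le> 2 * (a * ln (a / b) - a + b) + (a + b) / 4"
proof (cases "a = 0")
  case True
  then show ?thesis using assms by simp
next
  case False
  then have pos: "a > 0" "b > 0" using assms by force+
  define u v where "u = sqrt a" and "v = sqrt b"
  have uv: "u > 0" "v > 0" "a = u\<^sup>2" "b = v\<^sup>2"
    using pos by (simp_all add: u_def v_def)
  \<comment> \<open>Using the inequality at the ratio of the square roots, rather than at
    \<open>b / a\<close>, is what produces \<open>(u - v)\<^sup>2\<close>.\<close>
  have "ln (v / u) \<le> v / u - 1" using uv by (intro ln_le_minus_one) simp
  moreover have "ln (a / b) = - 2 * ln (v / u)"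
    using uv by (simp add: ln_div ln_realpow)
  ultimately have "a * ln (a / b) \<ge> a * (2 * (1 - v / u))"
    using pos by (intro mult_left_mono) auto
  moreover have "a * (2 * (1 - v / u)) = 2 * u\<^sup>2 - 2 * u * v"
    using uv by (simp add: field_simps power2_eq_square)
  ultimately have kl: "(u - v)\<^sup>2 \<le> a * ln (a / b) - a + b"
    using uv by (simp add: power2_eq_square algebra_simps)
  have "\<bar>a - b\<bar> = \<bar>u - v\<bar> * (u + v)"
    using uv by (simp add: power2_eq_square abs_mult square_diff_square_factored)
  \<comment> \<open>AM-GM, weighted so that the second part, after
    \<open>(u + v)\<^sup>2 \<le> 2 * (a + b)\<close>, costs only a quarter of the mass.\<close>
  also have "\<dots> \<le> 2 * (u - v)\<^sup>2 + (u + v)\<^sup>2 / 8"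
  proof -
    define w where "w = \<bar>u - v\<bar>"
    have "(u - v)\<^sup>2 = w\<^sup>2" by (simp add: w_def)
    then show ?thesis using zero_le_power2[of "4 * w - (u + v)"]
      unfolding w_def[symmetric] by (simp add: power2_eq_square field_simps)
  qed
  also have "\<dots> \<le> 2 * (u - v)\<^sup>2 + (a + b) / 4"
    using zero_le_power2[of "u - v"] uv by (simp add: power2_eq_square algebra_simps)
  finally show ?thesis
    by (rule order_trans) (use kl in simp)
qed

text \<open>The usual chi-square bound has \<open>b\<close> in the denominator. The likelihood ratio
  bound \<rho> moves it to \<open>a\<close>, so that one denominator serves all neighbours of
  \<open>a\<close>; the terms \<open>a - b\<close> cancel on summation.\<close>

lemma kl_le_chi_square:
  fixes a b \<rho> :: real
  assumes "0 \<le> a" "0 \<le> b" "a \<le> \<rho> * b" "b \<le> \<rho> * a"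
  shows "a * ln (a / b) \<le> a - b + \<rho> * ((a - b)\<^sup>2 / a)"
proof (cases "a = 0")
  case True
  then show ?thesis using assms by simp
next
  case False
  then have pos: "a > 0" using assms by simp
  have bpos: "b > 0" using assms pos by (cases "b = 0") auto
  have "ln (a / b) \<le> a / b - 1" using pos bpos by (intro ln_le_minus_one) simp
  then have "a * ln (a / b) \<le> a * (a / b - 1)"
    using pos by (intro mult_left_mono) auto
  also have "\<dots> = a - b + (a - b)\<^sup>2 * (1 / b)"
    using pos bpos by (simp add: field_simps power2_eq_square)
  also have "(a - b)\<^sup>2 * (1 / b) \<le> (a - b)\<^sup>2 * (\<rho> / a)"
    using pos bpos assms by (intro mult_left_mono) (auto simp: field_simps)
  finally show ?thesis by (simp add: mult.commute)
qed

section \<open>Transcript laws and the chain rule\<close>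

definition hists :: "'y set \<Rightarrow> nat \<Rightarrow> 'y list set" where
  "hists \<Omega> n = {h. length h = n \<and> set h \<subseteq> \<Omega>}"

text \<open>\<open>a h y\<close> is the conditional probability of message \<open>y\<close> after
  history \<open>h\<close>. This is \<open>hist_prob\<close> with the policy absorbed into the
  kernel; for an oracle that ignores its query the policy drops out.\<close>

definition path_prob :: "('y list \<Rightarrow> 'y \<Rightarrow> real) \<Rightarrow> 'y list \<Rightarrow> real" where
  "path_prob a h = (\<Prod>i<length h. a (take i h) (h ! i))"

lemma path_prob_Nil [simp]: "path_prob a [] = 1"
  by (simp add: path_prob_def)

lemma path_prob_snoc [simp]: "path_prob a (h @ [y]) = path_prob a h * a h y"
  unfolding path_prob_def by (auto simp: nth_append intro!: prod.cong)

lemma path_prob_nonneg: "(\<And>h y. 0 \<le> a h y) \<Longrightarrow> 0 \<le> path_prob a h"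
  unfolding path_prob_def by (intro prod_nonneg) auto

lemma path_prob_eq_0_iff: "path_prob a h = 0 \<longleftrightarrow> (\<exists>i<length h. a (take i h) (h ! i) = 0)"
  unfolding path_prob_def by auto

lemma hists_0 [simp]: "hists \<Omega> 0 = {[]}"
  by (auto simp: hists_def)

lemma sum_hists_Suc:
  assumes "finite \<Omega>"
  shows "(\<Sum>h\<in>hists \<Omega> (Suc n). F h) = (\<Sum>h\<in>hists \<Omega> n. \<Sum>y\<in>\<Omega>. F (h @ [y]))"
proof -
  have "bij_betw (\<lambda>(h, y). h @ [y]) (hists \<Omega> n \<times> \<Omega>) (hists \<Omega> (Suc n))"
  proof (rule bij_betw_imageI)
    show "inj_on (\<lambda>(h, y). h @ [y]) (hists \<Omega> n \<times> \<Omega>)"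
      by (auto simp: inj_on_def)
    have "\<exists>h'\<in>hists \<Omega> n. \<exists>y\<in>\<Omega>. h = h' @ [y]" if "h \<in> hists \<Omega> (Suc n)" for h
      using that by (cases h rule: rev_cases) (auto simp: hists_def)
    then show "(\<lambda>(h, y). h @ [y]) ` (hists \<Omega> n \<times> \<Omega>) = hists \<Omega> (Suc n)"
      by (fastforce simp: hists_def)
  qed
  from sum.reindex_bij_betw[OF this, of F] show ?thesis
    by (simp add: sum.cartesian_product case_prod_unfold)
qed

lemma sum_path_prob:
  assumes "finite \<Omega>" "\<And>h. (\<Sum>y\<in>\<Omega>. a h y) = 1"
  shows "(\<Sum>h\<in>hists \<Omega> n. path_prob a h) = 1"
  by (induction n) (simp_all add: sum_hists_Suc assms flip: sum_distrib_left)

text \<open>Only the sum over \<open>i\<close> of the one-step divergences is bounded, so the chain rule has to be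
  carried out for all \<open>b i\<close> at once.\<close>

lemma sum_kl_path_prob_le:
  fixes a :: "'y list \<Rightarrow> 'y \<Rightarrow> real" and b :: "'i \<Rightarrow> 'y list \<Rightarrow> 'y \<Rightarrow> real"
  assumes fin: "finite \<Omega>"
    and nonneg: "\<And>h y. 0 \<le> a h y" "\<And>i h y. 0 \<le> b i h y"
    and one: "\<And>h. (\<Sum>y\<in>\<Omega>. a h y) = 1" "\<And>i h. (\<Sum>y\<in>\<Omega>. b i h y) = 1"
    and ratio: "\<And>i h y. a h y \<le> \<rho> * b i h y" "\<And>i h y. b i h y \<le> \<rho> * a h y"
    and "0 \<le> \<rho>"
    and info: "\<And>h. (\<Sum>i\<in>I. \<Sum>y\<in>\<Omega>. (a h y - b i h y)\<^sup>2 / a h y) \<le> K"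
  shows "(\<Sum>i\<in>I. \<Sum>h\<in>hists \<Omega> n. path_prob a h * ln (path_prob a h / path_prob (b i) h))
           \<le> \<rho> * real n * K"
proof (induction n)
  case 0
  show ?case by simp
next
  case (Suc n)
  \<comment> \<open>The ratio bound gives absolute continuity, so every logarithm with positive
    weight has a positive argument.\<close>
  have b0: "a h y = 0" if "b i h y = 0" for i h y
    using ratio(1)[of h y i] nonneg(1)[of h y] that by simp
  have pos: "path_prob (b i) h > 0" if "path_prob a h > 0" for i h
  proof -
    have "path_prob (b i) h \<noteq> 0"
      using that b0 path_prob_eq_0_iff[of a h] path_prob_eq_0_iff[of "b i" h] by force
    then show ?thesis using path_prob_nonneg[of "b i" h] nonneg by simp
  qed
  have split: "path_prob a (h @ [y]) * ln (path_prob a (h @ [y]) / path_prob (b i) (h @ [y]))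
      = path_prob a h * ln (path_prob a h / path_prob (b i) h) * a h y
        + path_prob a h * (a h y * ln (a h y / b i h y))" for i h y
  proof (cases "path_prob a h = 0 \<or> a h y = 0")
    case False
    then have *: "path_prob a h > 0" "a h y > 0"
      using path_prob_nonneg[of a h] nonneg(1) by (simp_all add: less_le)
    moreover have "path_prob (b i) h > 0" "b i h y > 0"
      using pos[OF *(1)] b0[of i h y] nonneg(2)[of i h y] * by fastforce+
    ultimately show ?thesis
      by (simp add: ln_mult ln_div algebra_simps)
  qed auto
  have step: "(\<Sum>i\<in>I. \<Sum>y\<in>\<Omega>. a h y * ln (a h y / b i h y)) \<le> \<rho> * K" for h
  proof -
    have "(\<Sum>i\<in>I. \<Sum>y\<in>\<Omega>. a h y * ln (a h y / b i h y))
        \<le> (\<Sum>i\<in>I. \<Sum>y\<in>\<Omega>. a h y - b i h y + \<rho> * ((a h y - b i h y)\<^sup>2 / a h y))"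
      by (intro sum_mono kl_le_chi_square nonneg ratio)
    also have "\<dots> = \<rho> * (\<Sum>i\<in>I. \<Sum>y\<in>\<Omega>. (a h y - b i h y)\<^sup>2 / a h y)"
      by (simp add: sum.distrib sum_subtractf one sum_distrib_left)
    also have "\<dots> \<le> \<rho> * K"
      using info \<open>0 \<le> \<rho>\<close> by (intro mult_left_mono)
    finally show ?thesis .
  qed
  have "(\<Sum>i\<in>I. \<Sum>h\<in>hists \<Omega> (Suc n). path_prob a h * ln (path_prob a h / path_prob (b i) h))
      = (\<Sum>i\<in>I. \<Sum>h\<in>hists \<Omega> n. path_prob a h * ln (path_prob a h / path_prob (b i) h))
        + (\<Sum>i\<in>I. \<Sum>h\<in>hists \<Omega> n. path_prob a h * (\<Sum>y\<in>\<Omega>. a h y * ln (a h y / b i h y)))"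
    unfolding sum_hists_Suc[OF fin] split
    by (simp add: sum.distrib one flip: sum_distrib_left)
  \<comment> \<open>The weights of the histories come from \<open>a\<close> and are the same for all
    \<open>i\<close>, so the sum over \<open>i\<close> can be moved inside, where
    \<open>step\<close> bounds it.\<close>
  also have "(\<Sum>i\<in>I. \<Sum>h\<in>hists \<Omega> n. path_prob a h * (\<Sum>y\<in>\<Omega>. a h y * ln (a h y / b i h y)))
      = (\<Sum>h\<in>hists \<Omega> n. path_prob a h * (\<Sum>i\<in>I. \<Sum>y\<in>\<Omega>. a h y * ln (a h y / b i h y)))"
    by (subst sum.swap) (simp add: sum_distrib_left)
  also have "\<dots> \<le> (\<Sum>h\<in>hists \<Omega> n. path_prob a h * (\<rho> * K))"
    by (intro sum_mono mult_left_mono step path_prob_nonneg nonneg)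
  also have "\<dots> = \<rho> * K"
    by (simp add: sum_path_prob fin one flip: sum_distrib_right)
  finally show ?case using Suc by (simp add: algebra_simps)
qed

text \<open>\<open>abs_diff_le_kl\<close> summed over histories and \<open>i\<close>: all laws have
  mass 1, so the linear terms cancel and the quarters leave \<open>card I / 2\<close>.\<close>

lemma sum_abs_diff_path_prob_le:
  fixes a :: "'y list \<Rightarrow> 'y \<Rightarrow> real" and b :: "'i \<Rightarrow> 'y list \<Rightarrow> 'y \<Rightarrow> real"
  assumes fin: "finite \<Omega>"
    and nonneg: "\<And>h y. 0 \<le> a h y" "\<And>i h y. 0 \<le> b i h y"
    and one: "\<And>h. (\<Sum>y\<in>\<Omega>. a h y) = 1" "\<And>i h. (\<Sum>y\<in>\<Omega>. b i h y) = 1"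
    and ratio: "\<And>i h y. a h y \<le> \<rho> * b i h y" "\<And>i h y. b i h y \<le> \<rho> * a h y"
    and rho: "0 \<le> \<rho>"
    and info: "\<And>h. (\<Sum>i\<in>I. \<Sum>y\<in>\<Omega>. (a h y - b i h y)\<^sup>2 / a h y) \<le> K"
  shows "(\<Sum>i\<in>I. \<Sum>h\<in>hists \<Omega> n. \<bar>path_prob a h - path_prob (b i) h\<bar>)
           \<le> 2 * (\<rho> * real n * K) + real (card I) / 2"
proof -
  have z: "path_prob a h = 0" if b0: "path_prob (b i) h = 0" for i h
  proof -
    obtain k where "k < length h" "b i (take k h) (h ! k) = 0"
      using b0 path_prob_eq_0_iff[of "b i" h] by auto
    then show ?thesis
      using ratio(1)[of "take k h" "h ! k" i] nonneg(1)[of "take k h" "h ! k"]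
      by (auto simp: path_prob_eq_0_iff)
  qed
  have "(\<Sum>i\<in>I. \<Sum>h\<in>hists \<Omega> n. \<bar>path_prob a h - path_prob (b i) h\<bar>)
     \<le> (\<Sum>i\<in>I. \<Sum>h\<in>hists \<Omega> n. 2 * (path_prob a h * ln (path_prob a h / path_prob (b i) h)
          - path_prob a h + path_prob (b i) h) + (path_prob a h + path_prob (b i) h) / 4)"
    by (intro sum_mono abs_diff_le_kl path_prob_nonneg nonneg z)
  also have "\<dots> = 2 * (\<Sum>i\<in>I. \<Sum>h\<in>hists \<Omega> n. path_prob a h * ln (path_prob a h / path_prob (b i) h))
      + real (card I) / 2"
    by (simp add: sum.distrib sum_subtractf sum_path_prob fin one
        flip: sum_distrib_left sum_divide_distrib)
  finally show ?thesis
    using sum_kl_path_prob_le[where a = a and b = b and n = n, OF fin nonneg one ratio rho info] by linarith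
qed

section \<open>Reduction to the divergence of one message\<close>

abbreviation sgb :: "bool \<Rightarrow> real" where
  "sgb b \<equiv> if b then 1 else - 1"

definition flip :: "'n \<Rightarrow> ('n \<Rightarrow> bool) \<Rightarrow> 'n \<Rightarrow> bool" where
  "flip i v = v(i := \<not> v i)"

lemma flip_apply: "flip i v j = (if j = i then \<not> v i else v j)"
  by (simp add: flip_def)

lemma flip_flip [simp]: "flip i (flip i v) = v"
  by (auto simp: flip_def)

lemma sum_flip: "(\<Sum>v\<in>UNIV. F (flip i v)) = (\<Sum>v\<in>UNIV. F v)"
  by (rule sum.reindex_bij_witness[of _ "flip i" "flip i"]) auto

text \<open>Assouad's method: reindexing by \<open>flip i\<close> pairs each sign vector with its neighbour in
  direction \<open>i\<close>.\<close>

lemma assouad_linear: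
  fixes P :: "('n::finite \<Rightarrow> bool) \<Rightarrow> 'h \<Rightarrow> real" and x :: "'h \<Rightarrow> real^'n"
  assumes one: "\<And>v. (\<Sum>h\<in>H. P v h) = 1"
    and tv: "\<And>v. (\<Sum>i\<in>UNIV. \<Sum>h\<in>H. \<bar>P v h - P (flip i v) h\<bar>) \<le> real CARD('n)"
    and x: "\<And>h i. h \<in> H \<Longrightarrow> \<bar>x h $ i\<bar> \<le> a" and "0 \<le> a"
  shows "(\<Sum>v\<in>UNIV. \<Sum>h\<in>H. P v h * (\<Sum>i\<in>UNIV. a + sgb (v i) * x h $ i))
           \<ge> (\<Sum>v\<in>(UNIV :: ('n \<Rightarrow> bool) set). a * real CARD('n) / 2)"
proof -
  define L where "L i v = (\<Sum>h\<in>H. P v h * (a + sgb (v i) * x h $ i))" for i v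
  \<comment> \<open>The two-point bound: \<open>sgb (v i)\<close> changes sign under the flip, so
    \<open>x h $ i\<close> only multiplies the difference of the two laws, at a cost of at most
    \<open>a\<close> times their L1 distance.\<close>
  have pair: "L i v + L i (flip i v) \<ge> 2 * a - a * (\<Sum>h\<in>H. \<bar>P v h - P (flip i v) h\<bar>)" for i v
  proof -
    have "2 * a - a * (\<Sum>h\<in>H. \<bar>P v h - P (flip i v) h\<bar>)
        = (\<Sum>h\<in>H. a * (P v h + P (flip i v) h) - a * \<bar>P v h - P (flip i v) h\<bar>)"
      by (simp add: sum_subtractf sum.distrib one flip: sum_distrib_left)
    also have "\<dots> \<le> (\<Sum>h\<in>H. P v h * (a + sgb (v i) * x h $ i)
                    + P (flip i v) h * (a + sgb (flip i v i) * x h $ i))"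
    proof (intro sum_mono)
      fix h assume "h \<in> H"
      have "- (sgb (v i) * x h $ i * (P v h - P (flip i v) h))
              \<le> \<bar>sgb (v i) * x h $ i * (P v h - P (flip i v) h)\<bar>"
        by linarith
      also have "\<dots> = \<bar>x h $ i\<bar> * \<bar>P v h - P (flip i v) h\<bar>"
        by (simp add: abs_mult)
      also have "\<dots> \<le> a * \<bar>P v h - P (flip i v) h\<bar>"
        using x[OF \<open>h \<in> H\<close>] by (intro mult_right_mono) auto
      finally show "a * (P v h + P (flip i v) h) - a * \<bar>P v h - P (flip i v) h\<bar>
          \<le> P v h * (a + sgb (v i) * x h $ i) + P (flip i v) h * (a + sgb (flip i v i) * x h $ i)"
        by (simp add: flip_apply algebra_simps split: if_splits)
    qed
    finally show ?thesis by (simp add: L_def sum.distrib)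
  qed
  have "(\<Sum>v\<in>(UNIV :: ('n \<Rightarrow> bool) set). a * real CARD('n))
      = (\<Sum>v\<in>(UNIV :: ('n \<Rightarrow> bool) set). 2 * a * real CARD('n) - a * real CARD('n))"
    by (simp add: algebra_simps)
  also have "\<dots> \<le> (\<Sum>v\<in>UNIV. 2 * a * real CARD('n)
      - a * (\<Sum>i\<in>UNIV. \<Sum>h\<in>H. \<bar>P v h - P (flip i v) h\<bar>))"
    using tv \<open>0 \<le> a\<close> by (intro sum_mono diff_left_mono mult_left_mono)
  also have "\<dots> = (\<Sum>v\<in>UNIV. \<Sum>i\<in>UNIV. 2 * a - a * (\<Sum>h\<in>H. \<bar>P v h - P (flip i v) h\<bar>))"
    by (simp add: sum_subtractf sum_distrib_left)
  also have "\<dots> \<le> (\<Sum>v\<in>UNIV. \<Sum>i\<in>UNIV. L i v + L i (flip i v))"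
    by (intro sum_mono pair)
  \<comment> \<open>\<open>flip i\<close> permutes the sign vectors, so both halves have the same
    total; this 2 is the source of the final division by 2.\<close>
  also have "\<dots> = (\<Sum>i\<in>UNIV. (\<Sum>v\<in>UNIV. L i v) + (\<Sum>v\<in>UNIV. L i (flip i v)))"
    by (subst sum.swap) (simp add: sum.distrib)
  also have "\<dots> = 2 * (\<Sum>v\<in>UNIV. \<Sum>i\<in>UNIV. L i v)"
    by (simp add: sum_flip sum.swap[of "\<lambda>v i. L i v"] sum_distrib_left)
  also have "(\<lambda>v. \<Sum>i\<in>UNIV. L i v) = (\<lambda>v. \<Sum>h\<in>H. P v h * (\<Sum>i\<in>UNIV. a + sgb (v i) * x h $ i))"
    unfolding L_def by (subst sum.swap) (simp add: sum_distrib_left)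
  finally show ?thesis by (simp flip: sum_divide_distrib)
qed

section \<open>Linear objectives on a cube\<close>

definition cube :: "real \<Rightarrow> (real^'n) set" where
  "cube a = {x. \<forall>i. \<bar>x $ i\<bar> \<le> a}"

lemma cube_eq_cbox: "cube a = cbox (\<chi> i. - a) (\<chi> i. a)"
  by (auto simp: cube_def mem_box_cart abs_le_iff minus_le_iff)

definition sign_vec :: "real \<Rightarrow> ('n::finite \<Rightarrow> bool) \<Rightarrow> real^'n" where
  "sign_vec c v = (\<chi> i. c * sgb (v i))"

lemma sign_vec_nth [simp]: "sign_vec c v $ i = c * sgb (v i)"
  by (simp add: sign_vec_def)

lemma inner_sign_vec: "sign_vec c v \<bullet> x = c * (\<Sum>i\<in>UNIV. sgb (v i) * x $ i)"
  by (simp add: inner_vec_def sum_distrib_left mult.assoc)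

text \<open>The infimum is compared with the value at the corner opposite to \<open>v\<close>; the
  regret then splits into one nonnegative term per coordinate.\<close>

lemma sign_vec_diff_Inf_ge:
  fixes x :: "real^'n"
  assumes "0 \<le> c" "0 \<le> a" "x \<in> cube a"
  shows "sign_vec c v \<bullet> x - Inf ((\<bullet>) (sign_vec c v) ` cube a)
           \<ge> c * (\<Sum>i\<in>UNIV. a + sgb (v i) * x $ i)"
proof -
  \<comment> \<open>Compactness supplies the lower bound without which the real \<open>Inf\<close>
    says nothing about the elements of the set.\<close>
  have "compact ((\<bullet>) (sign_vec c v) ` (cube a :: (real^'n) set))"
    by (intro compact_continuous_image continuous_intros) (simp add: cube_eq_cbox compact_cbox)
  then have "bdd_below ((\<bullet>) (sign_vec c v) ` (cube a :: (real^'n) set))"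
    by (intro bounded_imp_bdd_below compact_imp_bounded)
  moreover have "sign_vec (- a) v \<in> cube a"
    using assms by (simp add: cube_def)
  ultimately have "Inf ((\<bullet>) (sign_vec c v) ` cube a) \<le> sign_vec c v \<bullet> sign_vec (- a) v"
    by (intro cInf_lower) auto
  also have "\<dots> = - c * (\<Sum>i\<in>(UNIV :: 'n set). a)"
  proof -
    have sgb: "sgb b * (- a * sgb b) = - a" for b by simp
    then show ?thesis unfolding inner_sign_vec sign_vec_nth sgb by simp
  qed
  finally show ?thesis
    by (simp add: inner_sign_vec sum.distrib algebra_simps)
qed

text \<open>A linear function has its coefficient vector as a subgradient at every point, so one
  fixed law with that mean is unbiased at every query.\<close>

lemma linear_oracle_in_oracle_class:
  fixes P :: "'s::finite pmf" and G :: "'s \<Rightarrow> real^'n"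
  assumes norm: "\<And>s. (lpnorm (conj_exp p) (G s))\<^sup>2 \<le> B\<^sup>2"
    and mean: "(\<Sum>s\<in>UNIV. pmf P s *\<^sub>R G s) = \<mu>"
    and X: "convex X"
  shows "((\<bullet>) \<mu>, \<lambda>_. distr (measure_pmf P) borel G) \<in> oracle_class X p B"
proof -
  have "prob_space (distr (measure_pmf P) borel G)"
    by (intro measure_pmf.prob_space_distr) simp
  then have 1: "(\<lambda>_. distr (measure_pmf P) borel G) \<in> borel \<rightarrow>\<^sub>M prob_algebra borel"
    by (intro measurable_const) (simp add: space_prob_algebra)
  \<comment> \<open>The norm bound is transferred through the finite, hence measurable, range of
    \<open>G\<close>; the measurability of \<open>lpnorm\<close> does not enter.\<close>
  have "range G \<in> sets borel"
    by (intro borel_closed finite_imp_closed) simp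
  then have "AE g in distr (measure_pmf P) borel G. g \<in> range G"
    by (subst AE_distr_iff) auto
  then have 2: "AE g in distr (measure_pmf P) borel G. (lpnorm (conj_exp p) g)\<^sup>2 \<le> B\<^sup>2"
    using norm by (auto elim!: eventually_mono)
  have 3: "(\<integral>g. g \<partial>distr (measure_pmf P) borel G) = \<mu>"
    unfolding mean[symmetric] by (subst integral_distr) (auto simp: integral_measure_pmf[of UNIV])
  have 4: "convex_on X ((\<bullet>) \<mu>)"
    using X by (auto simp: convex_on_def inner_add_right)
  show ?thesis using 1 2 3 4 unfolding oracle_class_def
    by (auto simp: subdiff_def inner_diff_right)
qed

text \<open>The interface shared by both constructions: only a family of laws on a finite sample
  space and three properties of it remain to be supplied. In \<open>info\<close>,
  \<open>w y s\<close> is the probability that the channel sends \<open>y\<close> on sample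
  \<open>s\<close>.\<close>

lemma minimax_err_cube_ge:
  fixes P :: "('n::finite \<Rightarrow> bool) \<Rightarrow> 's::finite pmf" and G :: "'s \<Rightarrow> real^'n"
  assumes norm: "\<And>s. (lpnorm (conj_exp p) (G s))\<^sup>2 \<le> B\<^sup>2"
    and mean: "\<And>v. (\<Sum>s\<in>UNIV. pmf (P v) s *\<^sub>R G s) = sign_vec c v"
    and ratio: "\<And>v i s. pmf (P v) s \<le> \<rho> * pmf (P (flip i v)) s"
    and info: "\<And>v (w :: bool list \<Rightarrow> 's \<Rightarrow> real).
        (\<And>y s. 0 \<le> w y s) \<Longrightarrow> (\<And>s. (\<Sum>y | length y = r. w y s) = 1) \<Longrightarrow>
        (\<Sum>i\<in>UNIV. \<Sum>y | length y = r.
           ((\<Sum>s\<in>UNIV. pmf (P v) s * w y s) - (\<Sum>s\<in>UNIV. pmf (P (flip i v)) s * w y s))\<^sup>2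
             / (\<Sum>s\<in>UNIV. pmf (P v) s * w y s)) \<le> K"
    and "0 \<le> \<rho>" "0 \<le> c" "0 \<le> a"
    and small: "\<rho> * real T * K \<le> real CARD('n) / 4"
  shows "minimax_err (cube a :: (real^'n) set) p B T r \<ge> ereal (c * a * real CARD('n) / 2)"
  unfolding minimax_err_def
proof (intro INF_greatest, safe)
  fix M :: "(bool list list \<Rightarrow> real^'n) measure" and S :: "bool list list \<Rightarrow> real^'n \<Rightarrow> bool list pmf"
  assume alg: "valid_alg (cube a) M" and S: "\<forall>h. S h \<in> com_channels r"
  let ?\<Omega> = "{y :: bool list. length y = r}"
  let ?O = "\<lambda>v _. distr (measure_pmf (P v)) borel G"
  \<comment> \<open>The law of the next message after history \<open>h\<close>. The policy does not
    occur, since the oracle ignores the query; adaptivity survives only through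
    \<open>S h\<close>.\<close>
  define W where "W v h y = (\<Sum>s\<in>UNIV. pmf (P v) s * pmf (S h (G s)) y)" for v h y
  define err where "err v \<phi> = det_err ((\<bullet>) (sign_vec c v)) (?O v) S \<phi> (cube a) T r" for v \<phi>
  have fin: "finite ?\<Omega>"
    using finite_lists_length_eq[of "UNIV :: bool set" r] by simp
  have W_int: "(\<integral>g. pmf (S h g) y \<partial>distr (measure_pmf (P v)) borel G) = W v h y" for v h y
    using S unfolding W_def com_channels_def
    by (subst integral_distr) (auto simp: integral_measure_pmf[of UNIV])
  have hist: "hist_prob (?O v) S \<phi> h = path_prob (W v) h" for v \<phi> h
    by (simp add: hist_prob_def path_prob_def W_int)
  have W_nonneg: "0 \<le> W v h y" for v h y
    unfolding W_def by (intro sum_nonneg) simp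
  have chan: "(\<Sum>y\<in>?\<Omega>. pmf (S h g) y) = 1" for h g
    using S fin unfolding com_channels_def by (intro sum_pmf_eq_1) auto
  have W_one: "(\<Sum>y\<in>?\<Omega>. W v h y) = 1" for v h
    unfolding W_def by (subst sum.swap) (simp add: chan sum_pmf_eq_1 flip: sum_distrib_left)
  \<comment> \<open>Likelihood ratio bounds survive post-processing by a channel.\<close>
  have W_ratio: "W v h y \<le> \<rho> * W (flip i v) h y" for v i h y
    unfolding W_def sum_distrib_left mult.assoc[symmetric]
    by (intro sum_mono mult_right_mono ratio) simp
  have W_ratio': "W (flip i v) h y \<le> \<rho> * W v h y" for v i h y
    using W_ratio[of "flip i v" h y i] by simp
  have W_info: "(\<Sum>i\<in>UNIV. \<Sum>y\<in>?\<Omega>. (W v h y - W (flip i v) h y)\<^sup>2 / W v h y) \<le> K" for v h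
    unfolding W_def by (rule info) (auto simp: chan)
  have hists: "{h. length h = T \<and> (\<forall>y\<in>set h. length y = r)} = hists ?\<Omega> T"
    by (auto simp: hists_def)
  have err: "err v \<phi> = (\<Sum>h\<in>hists ?\<Omega> T. path_prob (W v) h
      * (sign_vec c v \<bullet> \<phi> h - Inf ((\<bullet>) (sign_vec c v) ` cube a)))" for v \<phi>
    by (simp add: err_def det_err_def hist hists)
  \<comment> \<open>By \<open>small\<close>, the divergence part is at most
    \<open>2 * (d / 4)\<close> for \<open>d = CARD('n)\<close>; with the additional
    \<open>d / 2\<close> this is exactly the bound \<open>d\<close> that Assouad's method
    needs.\<close>
  have tv: "(\<Sum>i\<in>UNIV. \<Sum>h\<in>hists ?\<Omega> T. \<bar>path_prob (W v) h - path_prob (W (flip i v)) h\<bar>)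
      \<le> real CARD('n)" for v
    using sum_abs_diff_path_prob_le[where a = "W v" and b = "\<lambda>i. W (flip i v)" and n = T,
        OF fin W_nonneg W_nonneg W_one W_one W_ratio W_ratio' \<open>0 \<le> \<rho>\<close> W_info] small by (simp add: mult.commute mult.left_commute)
  interpret M: prob_space M using alg by (simp add: valid_alg_def)
  have sets_M: "sets M = sets (\<Pi>\<^sub>M h\<in>UNIV. restrict_space borel (cube a))"
    using alg by (simp add: valid_alg_def)
  have M_cube: "\<phi> h \<in> cube a" if "\<phi> \<in> space M" for \<phi> h
    using that sets_eq_imp_space_eq[OF sets_M]
    by (auto simp: space_PiM space_restrict_space PiE_def Pi_def)
  have meas: "(\<lambda>\<phi>. \<phi> h) \<in> borel_measurable M" for h
  proof -
    have "(\<lambda>\<phi>. \<phi> h) \<in> measurable (\<Pi>\<^sub>M h\<in>UNIV. restrict_space borel (cube a :: (real^'n) set))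
        (restrict_space borel (cube a))"
      by (rule measurable_component_singleton) simp
    then show ?thesis
      unfolding measurable_cong_sets[OF sets_M refl] measurable_restrict_space2_iff by simp
  qed
  \<comment> \<open>The error is a finite sum of terms bounded on the cube, so its integral is a
    true expectation and not the default 0.\<close>
  have int: "integrable M (err v)" for v
  proof -
    obtain C where C: "norm x \<le> C" if "x \<in> cube a" for x :: "real^'n"
      using bounded_cbox unfolding cube_eq_cbox bounded_iff by blast
    have "integrable M (\<lambda>\<phi>. sign_vec c v \<bullet> \<phi> h)" for h
    proof (intro integrable_inner_right M.integrable_const_bound[of _ C] AE_I2)
    qed (use meas C M_cube in auto)
    then show ?thesis unfolding err
      by (intro Bochner_Integration.integrable_sum integrable_mult_right
          Bochner_Integration.integrable_diff) auto
  qed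
  let ?b = "c * a * real CARD('n) / 2"
  have "(\<Sum>v\<in>(UNIV :: ('n \<Rightarrow> bool) set). ?b) \<le> (\<Sum>v\<in>UNIV. err v \<phi>)" if "\<phi> \<in> space M" for \<phi>
  proof -
    have "(\<Sum>v\<in>(UNIV :: ('n \<Rightarrow> bool) set). ?b)
        = c * (\<Sum>v\<in>(UNIV :: ('n \<Rightarrow> bool) set). a * real CARD('n) / 2)"
      by simp
    also have "\<dots> \<le> c * (\<Sum>v\<in>UNIV. \<Sum>h\<in>hists ?\<Omega> T. path_prob (W v) h
        * (\<Sum>i\<in>UNIV. a + sgb (v i) * \<phi> h $ i))"
      using \<open>0 \<le> c\<close> \<open>0 \<le> a\<close> M_cube[OF that] sum_path_prob[OF fin, of "W _" T] W_one
      by (intro mult_left_mono assouad_linear tv) (auto simp: cube_def)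
    also have "\<dots> = (\<Sum>v\<in>UNIV. \<Sum>h\<in>hists ?\<Omega> T. path_prob (W v) h
        * (c * (\<Sum>i\<in>UNIV. a + sgb (v i) * \<phi> h $ i)))"
      unfolding sum_distrib_left by (simp add: mult_ac)
    also have "\<dots> \<le> (\<Sum>v\<in>UNIV. err v \<phi>)"
      unfolding err using that M_cube \<open>0 \<le> c\<close> \<open>0 \<le> a\<close>
      by (intro sum_mono mult_left_mono sign_vec_diff_Inf_ge path_prob_nonneg W_nonneg) auto
    finally show ?thesis .
  qed
  then have "(\<Sum>v\<in>(UNIV :: ('n \<Rightarrow> bool) set). ?b) \<le> (\<integral>\<phi>. (\<Sum>v\<in>UNIV. err v \<phi>) \<partial>M)"
    using int by (intro M.integral_ge_const AE_I2 Bochner_Integration.integrable_sum) auto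
  also have "\<dots> = (\<Sum>v\<in>UNIV. \<integral>\<phi>. err v \<phi> \<partial>M)"
    using int by (intro Bochner_Integration.integral_sum)
  \<comment> \<open>The average over \<open>v\<close> is large for every deterministic policy, hence
    also under \<open>M\<close>, so some \<open>v\<close> is bad. It may depend on \<open>M\<close>
    and \<open>S\<close>, as the supremum stands inside the infimum.\<close>
  finally obtain v where v: "?b \<le> (\<integral>\<phi>. err v \<phi> \<partial>M)"
    using sum_strict_mono[of "UNIV :: ('n \<Rightarrow> bool) set" "\<lambda>v. \<integral>\<phi>. err v \<phi> \<partial>M" "\<lambda>_. ?b"]
    by (meson UNIV_not_empty finite not_le)
  have "convex (cube a :: (real^'n) set)"
    by (simp add: cube_eq_cbox convex_box)
  from linear_oracle_in_oracle_class[OF norm mean this]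
  show "ereal ?b \<le> (SUP fO\<in>oracle_class (cube a) p B.
        ereal (\<integral>\<phi>. det_err (fst fO) (snd fO) (snd (M, S)) \<phi> (cube a) T r \<partial>fst (M, S)))"
    by (rule SUP_upper2) (use v in \<open>simp add: err_def\<close>)
qed

section \<open>Random coordinates\<close>

lemma pmf_embed_finite:
  fixes f :: "'s::finite \<Rightarrow> real"
  assumes "\<And>s. 0 \<le> f s" "(\<Sum>s\<in>UNIV. f s) = 1"
  shows "pmf (embed_pmf f) s = f s"
  using assms by (intro pmf_embed_pmf) (auto simp: nn_integral_count_space_finite)

text \<open>The pair \<open>(i, s)\<close> encodes the oracle answer
  \<open>axis i (sgb s * B)\<close>: a uniform coordinate whose sign agrees with \<open>v i\<close>
  with probability \<open>(1 + \<delta>) / 2\<close>.\<close>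

definition coord_weight :: "real \<Rightarrow> ('n::finite \<Rightarrow> bool) \<Rightarrow> 'n \<times> bool \<Rightarrow> real" where
  "coord_weight \<delta> v = (\<lambda>(i, s). (1 + \<delta> * sgb (v i) * sgb s) / (2 * real CARD('n)))"

lemma sum_pair_bool: "(\<Sum>z\<in>(UNIV :: ('n::finite \<times> bool) set). F z) = (\<Sum>i\<in>UNIV. F (i, True) + F (i, False))"
proof -
  have "(\<Sum>z\<in>UNIV. F z) = (\<Sum>i\<in>UNIV. \<Sum>s\<in>UNIV. F (i, s))"
    by (simp add: sum.cartesian_product)
  then show ?thesis by (simp add: UNIV_bool add.commute)
qed

lemma coord_weight_bounds:
  fixes v :: "'n::finite \<Rightarrow> bool"
  assumes "0 \<le> \<delta>" "\<delta> < 1"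
  shows "(1 - \<delta>) / (2 * real CARD('n)) \<le> coord_weight \<delta> v z"
    and "coord_weight \<delta> v z \<le> (1 + \<delta>) / (2 * real CARD('n))"
  using assms by (auto simp: coord_weight_def split_beta intro!: divide_right_mono)

lemma coord_weight_nonneg: "0 \<le> \<delta> \<Longrightarrow> \<delta> < 1 \<Longrightarrow> 0 \<le> coord_weight \<delta> v z"
  by (auto simp: coord_weight_def split_beta)

lemma sum_coord_weight: "(\<Sum>z\<in>UNIV. coord_weight \<delta> v z) = 1"
  by (simp add: sum_pair_bool coord_weight_def flip: add_divide_distrib)

lemma coord_weight_ratio:
  assumes "0 \<le> \<delta>" "\<delta> < 1"
  shows "coord_weight \<delta> v z \<le> (1 + \<delta>) / (1 - \<delta>) * coord_weight \<delta> v' z"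
proof -
  have "(1 + \<delta>) / (2 * real CARD('a)) = (1 + \<delta>) / (1 - \<delta>) * ((1 - \<delta>) / (2 * real CARD('a)))"
    using assms by simp
  also have "\<dots> \<le> (1 + \<delta>) / (1 - \<delta>) * coord_weight \<delta> v' z"
    using assms by (intro mult_left_mono coord_weight_bounds) auto
  finally show ?thesis using coord_weight_bounds(2)[OF assms, of v z] by linarith
qed

lemma mean_coord_weight:
  fixes v :: "'n::finite \<Rightarrow> bool"
  shows "(\<Sum>z\<in>UNIV. coord_weight \<delta> v z *\<^sub>R axis (fst z) (sgb (snd z) * B))
           = sign_vec (\<delta> * B / real CARD('n)) v"
proof -
  have "coord_weight \<delta> v (i, True) * B - coord_weight \<delta> v (i, False) * B
      = \<delta> * B / real CARD('n) * sgb (v i)" for i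
    by (simp add: coord_weight_def field_simps)
  then show ?thesis
    by (simp add: vec_eq_iff sum_pair_bool axis_def sum.distrib if_distrib cong: if_cong)
qed

text \<open>Flipping sign \<open>i\<close> changes only the two atoms over coordinate
  \<open>i\<close>. Message \<open>y\<close> therefore contributes order
  \<open>\<delta>\<^sup>2 / d * min 1 (A y)\<close>, where \<open>A y\<close> is the sum of
  \<open>w y\<close> over all samples. Bounding the minimum by 1 counts the messages, bounding it by
  \<open>A y\<close> counts the samples.\<close>

lemma coord_weight_info:
  fixes v :: "'n::finite \<Rightarrow> bool" and w :: "'y \<Rightarrow> 'n \<times> bool \<Rightarrow> real"
  assumes "0 \<le> \<delta>" "\<delta> < 1" and fin: "finite \<Omega>"
    and w0: "\<And>y z. 0 \<le> w y z" and w1: "\<And>z. (\<Sum>y\<in>\<Omega>. w y z) = 1"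
  shows "(\<Sum>i\<in>UNIV. \<Sum>y\<in>\<Omega>.
           ((\<Sum>z\<in>UNIV. coord_weight \<delta> v z * w y z) - (\<Sum>z\<in>UNIV. coord_weight \<delta> (flip i v) z * w y z))\<^sup>2
             / (\<Sum>z\<in>UNIV. coord_weight \<delta> v z * w y z))
         \<le> 4 * \<delta>\<^sup>2 * min (real (card \<Omega>)) (real CARD('n)) / (real CARD('n) * (1 - \<delta>))"
proof -
  define d where "d = real CARD('n)"
  have d: "d > 0" by (simp add: d_def)
  define A where "A y = (\<Sum>i\<in>UNIV. w y (i, True) + w y (i, False))" for y
  define Q where "Q y = (\<Sum>z\<in>UNIV. coord_weight \<delta> v z * w y z)" for y
  define C where "C = 2 * \<delta>\<^sup>2 / (d * (1 - \<delta>))"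
  have C: "0 \<le> C" using assms d by (simp add: C_def)
  have w_le: "w y z \<le> 1" if "y \<in> \<Omega>" for y z
    using member_le_sum[OF that, of "\<lambda>y. w y z"] w0 w1 fin by simp
  have A0: "0 \<le> A y" for y
    unfolding A_def by (intro sum_nonneg add_nonneg_nonneg w0)
  have diff: "Q y - (\<Sum>z\<in>UNIV. coord_weight \<delta> (flip i v) z * w y z)
      = \<delta> / d * sgb (v i) * (w y (i, True) - w y (i, False))" for i y
  proof -
    have "coord_weight \<delta> v z * w y z - coord_weight \<delta> (flip i v) z * w y z
        = (if fst z = i then \<delta> / d * sgb (v i) * sgb (snd z) * w y z else 0)" for z
      using d by (auto simp: coord_weight_def d_def flip_apply split_beta field_simps)
    then have "Q y - (\<Sum>z\<in>UNIV. coord_weight \<delta> (flip i v) z * w y z)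
        = (\<Sum>z\<in>UNIV. if fst z = i then \<delta> / d * sgb (v i) * sgb (snd z) * w y z else 0)"
      unfolding Q_def sum_subtractf[symmetric] by simp
    also have "\<dots> = \<delta> / d * sgb (v i) * (w y (i, True) - w y (i, False))"
      unfolding sum_pair_bool by (simp add: sum.distrib algebra_simps)
    finally show ?thesis .
  qed
  have Q_ge: "(1 - \<delta>) / (2 * d) * A y \<le> Q y" for y
  proof -
    have "(1 - \<delta>) / (2 * d) * A y = (\<Sum>z\<in>UNIV. (1 - \<delta>) / (2 * d) * w y z)"
      unfolding A_def sum_pair_bool[symmetric] sum_distrib_left ..
    also have "\<dots> \<le> Q y"
      unfolding Q_def d_def using assms
      by (intro sum_mono mult_right_mono coord_weight_bounds w0)
    finally show ?thesis .
  qed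
  \<comment> \<open>One factor of each square is bounded by \<open>min 1 (A y)\<close>, the other by
    the sum of the two entries; the latter adds up to \<open>A y\<close>, which cancels against
    \<open>Q_ge\<close>.\<close>
  have sq: "(\<Sum>i\<in>UNIV. (w y (i, True) - w y (i, False))\<^sup>2) \<le> min 1 (A y) * A y" if "y \<in> \<Omega>" for y
  proof -
    have "(\<Sum>i\<in>UNIV. (w y (i, True) - w y (i, False))\<^sup>2)
        \<le> (\<Sum>i\<in>UNIV. min 1 (A y) * (w y (i, True) + w y (i, False)))"
    proof (intro sum_mono)
      fix i
      let ?x = "w y (i, True)" and ?x' = "w y (i, False)"
      have "?x + ?x' \<le> A y"
        unfolding A_def using w0 by (intro member_le_sum) auto
      then have "\<bar>?x - ?x'\<bar> \<le> min 1 (A y)" "\<bar>?x - ?x'\<bar> \<le> ?x + ?x'"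
        using w0[of y "(i, True)"] w0[of y "(i, False)"] w_le[OF that, of "(i, True)"]
          w_le[OF that, of "(i, False)"] by linarith+
      then have "\<bar>?x - ?x'\<bar> * \<bar>?x - ?x'\<bar> \<le> min 1 (A y) * (?x + ?x')"
        using A0[of y] by (intro mult_mono) auto
      then show "(?x - ?x')\<^sup>2 \<le> min 1 (A y) * (?x + ?x')"
        by (simp add: power2_eq_square)
    qed
    then show ?thesis by (simp add: A_def flip: sum_distrib_left)
  qed
  have per_y: "(\<Sum>i\<in>UNIV. (\<delta> / d * sgb (v i) * (w y (i, True) - w y (i, False)))\<^sup>2 / Q y)
      \<le> C * min 1 (A y)" if "y \<in> \<Omega>" for y
  proof (cases "A y = 0")
    case True
    then have "w y z = 0" for z
      using sum_nonneg_eq_0_iff[of "UNIV :: ('n \<times> bool) set" "w y"] w0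
      by (cases z) (simp add: A_def flip: sum_pair_bool)
    then show ?thesis using True by simp
  next
    case False
    then have A: "A y > 0" using A0[of y] by simp
    have "(\<Sum>i\<in>UNIV. (\<delta> / d * sgb (v i) * (w y (i, True) - w y (i, False)))\<^sup>2 / Q y)
        = (\<delta> / d)\<^sup>2 * (\<Sum>i\<in>UNIV. (w y (i, True) - w y (i, False))\<^sup>2) / Q y"
      unfolding sum_distrib_left sum_divide_distrib
      by (intro sum.cong refl) (auto simp: power2_eq_square)
    also have "\<dots> \<le> (\<delta> / d)\<^sup>2 * (min 1 (A y) * A y) / ((1 - \<delta>) / (2 * d) * A y)"
      using sq[OF that] Q_ge A A0 d assms
      by (intro frac_le mult_left_mono mult_nonneg_nonneg) auto
    also have "\<dots> = C * min 1 (A y)"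
      using A d assms by (simp add: C_def power2_eq_square field_simps)
    finally show ?thesis .
  qed
  have "(\<Sum>i\<in>UNIV. \<Sum>y\<in>\<Omega>. (Q y - (\<Sum>z\<in>UNIV. coord_weight \<delta> (flip i v) z * w y z))\<^sup>2 / Q y)
      \<le> (\<Sum>y\<in>\<Omega>. C * min 1 (A y))"
    unfolding diff by (subst sum.swap) (intro sum_mono per_y)
  also have "\<dots> = C * (\<Sum>y\<in>\<Omega>. min 1 (A y))"
    by (simp add: sum_distrib_left)
  also have "\<dots> \<le> C * (2 * min (real (card \<Omega>)) d)"
  proof (intro mult_left_mono C)
    have "(\<Sum>y\<in>\<Omega>. min 1 (A y)) \<le> (\<Sum>y\<in>\<Omega>. 1)" "(\<Sum>y\<in>\<Omega>. min 1 (A y)) \<le> (\<Sum>y\<in>\<Omega>. A y)"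
      by (intro sum_mono; simp)+
    moreover have "(\<Sum>y\<in>\<Omega>. A y) = 2 * d"
      unfolding A_def d_def by (subst sum.swap) (simp add: sum.distrib w1)
    ultimately show "(\<Sum>y\<in>\<Omega>. min 1 (A y)) \<le> 2 * min (real (card \<Omega>)) d"
      by simp
  qed
  also have "\<dots> = 4 * \<delta>\<^sup>2 * min (real (card \<Omega>)) d / (d * (1 - \<delta>))"
    by (simp add: C_def)
  finally show ?thesis unfolding Q_def d_def .
qed

section \<open>Product distributions\<close>

lemma sum_prod_bool_fun:
  fixes g :: "'n::finite \<Rightarrow> bool \<Rightarrow> real"
  shows "(\<Sum>s\<in>UNIV. \<Prod>i\<in>UNIV. g i (s i)) = (\<Prod>i\<in>UNIV. g i True + g i False)"
proof -
  have "(\<Prod>i\<in>UNIV. \<Sum>b\<in>UNIV. g i b) = (\<Sum>s\<in>UNIV. \<Prod>i\<in>UNIV. g i (s i))"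
    by (simp add: prod_sum_PiE PiE_UNIV_domain)
  then show ?thesis by (simp add: UNIV_bool add.commute)
qed

definition prod_weight :: "real \<Rightarrow> ('n::finite \<Rightarrow> bool) \<Rightarrow> ('n \<Rightarrow> bool) \<Rightarrow> real" where
  "prod_weight \<delta> v s = (\<Prod>i\<in>UNIV. (1 + \<delta> * (sgb (v i) * sgb (s i))) / 2)"

text \<open>The relative change \<open>1 - (1 - \<delta> * u) / (1 + \<delta> * u)\<close> of the
  weight under a flip, where \<open>u\<close> tells whether sample and parameter agree. It has mean
  zero under the biased sign.\<close>

definition score :: "real \<Rightarrow> real \<Rightarrow> real" where
  "score \<delta> u = 2 * \<delta> * u / (1 + \<delta> * u)"

lemma prod_weight_nonneg: "0 \<le> \<delta> \<Longrightarrow> \<delta> < 1 \<Longrightarrow> 0 \<le> prod_weight \<delta> v s"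
  unfolding prod_weight_def by (intro prod_nonneg) auto

lemma sum_prod_weight: "(\<Sum>s\<in>UNIV. prod_weight \<delta> v s) = 1"
  unfolding prod_weight_def
  by (subst sum_prod_bool_fun[of "\<lambda>i b. (1 + \<delta> * (sgb (v i) * sgb b)) / 2"])
     (simp flip: add_divide_distrib)

lemma mean_prod_weight:
  "(\<Sum>s\<in>UNIV. prod_weight \<delta> v s *\<^sub>R sign_vec b s) = sign_vec (\<delta> * b) v"
proof -
  have "(\<Sum>s\<in>UNIV. prod_weight \<delta> v s * (b * sgb (s j))) = \<delta> * b * sgb (v j)" for j
  proof -
    let ?g = "\<lambda>i t. (1 + \<delta> * (sgb (v i) * sgb t)) / 2 * (if i = j then sgb t else 1)"
    have "(\<Sum>s\<in>UNIV. prod_weight \<delta> v s * sgb (s j)) = (\<Sum>s\<in>UNIV. \<Prod>i\<in>UNIV. ?g i (s i))"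
      unfolding prod_weight_def prod.distrib by simp
    also have "\<dots> = (\<Prod>i\<in>UNIV. if i = j then \<delta> * sgb (v j) else 1)"
      unfolding sum_prod_bool_fun[of ?g]
      by (intro prod.cong refl) (auto simp: field_simps)
    also have "\<dots> = \<delta> * sgb (v j)" by simp
    finally show ?thesis
      by (simp add: mult.left_commute[of _ b] mult.assoc flip: sum_distrib_left)
  qed
  then show ?thesis by (simp add: vec_eq_iff)
qed

lemma prod_weight_flip:
  assumes "0 \<le> \<delta>" "\<delta> < 1"
  shows "prod_weight \<delta> (flip i v) s
           = prod_weight \<delta> v s * ((1 - \<delta> * (sgb (v i) * sgb (s i))) / (1 + \<delta> * (sgb (v i) * sgb (s i))))"
proof -
  define R where "R = (\<Prod>j\<in>UNIV - {i}. (1 + \<delta> * (sgb (v j) * sgb (s j))) / 2)"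
  have pw: "prod_weight \<delta> v s = (1 + \<delta> * (sgb (v i) * sgb (s i))) / 2 * R"
    unfolding prod_weight_def R_def by (rule prod.remove) auto
  have pw_flip: "prod_weight \<delta> (flip i v) s = (1 - \<delta> * (sgb (v i) * sgb (s i))) / 2 * R"
  proof -
    have "(\<Prod>j\<in>UNIV - {i}. (1 + \<delta> * (sgb (flip i v j) * sgb (s j))) / 2) = R"
      unfolding R_def by (intro prod.cong) (auto simp: flip_apply)
    then show ?thesis
      unfolding prod_weight_def by (subst prod.remove[of _ i]) (auto simp: flip_apply)
  qed
  have "1 + \<delta> * (sgb (v i) * sgb (s i)) \<noteq> 0" using assms by auto
  moreover have "y / 2 * R = x / 2 * R * (y / x)" if "x \<noteq> 0" for x y
    using that by simp
  ultimately show ?thesis unfolding pw pw_flip by blast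
qed

lemma prod_weight_diff:
  assumes "0 \<le> \<delta>" "\<delta> < 1"
  shows "prod_weight \<delta> v s - prod_weight \<delta> (flip i v) s
           = prod_weight \<delta> v s * score \<delta> (sgb (v i) * sgb (s i))"
  unfolding prod_weight_flip[OF assms] score_def using assms by (auto simp: field_simps)

lemma prod_weight_ratio:
  assumes "0 \<le> \<delta>" "\<delta> < 1"
  shows "prod_weight \<delta> v s \<le> (1 + \<delta>) / (1 - \<delta>) * prod_weight \<delta> (flip i v) s"
proof -
  let ?u = "sgb (v i) * sgb (s i)"
  have "1 = (1 + \<delta>) / (1 - \<delta>) * ((1 - \<delta>) / (1 + \<delta>))"
    using assms by simp
  also have "\<dots> \<le> (1 + \<delta>) / (1 - \<delta>) * ((1 - \<delta> * ?u) / (1 + \<delta> * ?u))"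
    using assms by (intro mult_left_mono frac_le) auto
  finally have "1 \<le> (1 + \<delta>) / (1 - \<delta>) * ((1 - \<delta> * ?u) / (1 + \<delta> * ?u))" .
  then have "prod_weight \<delta> v s * 1
      \<le> prod_weight \<delta> v s * ((1 + \<delta>) / (1 - \<delta>) * ((1 - \<delta> * ?u) / (1 + \<delta> * ?u)))"
    using assms by (intro mult_left_mono prod_weight_nonneg) auto
  then show ?thesis unfolding prod_weight_flip[OF assms] by (simp add: mult_ac)
qed

section \<open>Sub-Gaussian score and the level-1 inequality\<close>

lemma two_point_mgf:
  fixes p h :: real
  assumes "0 \<le> p" "p \<le> 1"
  shows "(1 - p) * exp (- h * p) + p * exp (h * (1 - p)) \<le> exp (h\<^sup>2 / 8)"
proof -
  have pos: "(1 - q) * exp (- k * q) + q * exp (k * (1 - q)) \<le> exp (k\<^sup>2 / 8)"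
    if "0 \<le> q" "q \<le> 1" "0 \<le> k" for q k :: real
  proof -
    have "1 + q * (exp k - 1) > 0"
      using that by (intro add_pos_nonneg mult_nonneg_nonneg) auto
    then have "exp (- k * q) * (1 + q * (exp k - 1)) = exp (- k * q + ln (1 + q * (exp k - 1)))"
      unfolding exp_add by simp
    also have "\<dots> \<le> exp (k\<^sup>2 / 8)"
      using Hoeffdings_lemma_aux[of k q] that by simp
    also have "exp (- k * q) * (1 + q * (exp k - 1)) = (1 - q) * exp (- k * q) + q * exp (k * (1 - q))"
      by (simp add: algebra_simps flip: exp_add)
    finally show ?thesis .
  qed
  show ?thesis
  proof (cases "0 \<le> h")
    case True
    then show ?thesis using pos assms by blast
  next
    case False
    then show ?thesis using pos[of "1 - p" "- h"] assms by (simp add: algebra_simps)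
  qed
qed

text \<open>The score is a centred two-point variable, so Hoeffding's lemma applies with the gap
  between its values as range.\<close>

lemma score_mgf:
  assumes "0 \<le> \<delta>" "\<delta> < 1"
  shows "(1 + \<delta>) / 2 * exp (t * score \<delta> 1) + (1 - \<delta>) / 2 * exp (t * score \<delta> (- 1))
           \<le> exp (2 * \<delta>\<^sup>2 / (1 - \<delta>\<^sup>2)\<^sup>2 * t\<^sup>2)"
proof -
  \<comment> \<open>\<open>t\<close> times the gap \<open>2 * \<delta> / (1 + \<delta>) + 2 *
    \<delta> / (1 - \<delta>)\<close>.\<close>
  define h where "h = 4 * \<delta> * t / (1 - \<delta>\<^sup>2)"
  have nz: "1 - \<delta> \<noteq> 0" "1 + \<delta> \<noteq> 0" using assms by auto
  have eq: "1 - \<delta>\<^sup>2 = (1 - \<delta>) * (1 + \<delta>)"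
    by (simp add: power2_eq_square algebra_simps)
  have score: "t * score \<delta> 1 = h * (1 - (1 + \<delta>) / 2)" "t * score \<delta> (- 1) = - h * ((1 + \<delta>) / 2)"
    unfolding h_def eq score_def using nz by (simp_all add: divide_simps)
  have h2: "h\<^sup>2 / 8 = 2 * \<delta>\<^sup>2 / (1 - \<delta>\<^sup>2)\<^sup>2 * t\<^sup>2"
    by (simp add: h_def power_divide power_mult_distrib)
  have half: "(1 - \<delta>) / 2 = 1 - (1 + \<delta>) / 2" by (simp add: field_simps)
  show ?thesis
    unfolding score h2[symmetric] half
    by (subst add.commute) (rule two_point_mgf; use assms in simp)
qed

text \<open>Level-1 inequality: the means \<open>m i\<close> are estimated by the Gibbs variational principle, with the
  exponential tilt \<open>\<theta> = m / (2 \<tau>)\<close>.\<close>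

lemma prod_weight_level_one:
  fixes v :: "'n::finite \<Rightarrow> bool" and w :: "('n \<Rightarrow> bool) \<Rightarrow> real" and \<delta> Q :: real
  defines "\<psi> \<equiv> \<lambda>i s. score \<delta> (sgb (v i) * sgb (s i))"
  assumes \<delta>: "0 < \<delta>" "\<delta> < 1" and w: "\<And>s. 0 \<le> w s" "\<And>s. w s \<le> 1"
    and Q: "Q = (\<Sum>s\<in>UNIV. prod_weight \<delta> v s * w s)" "Q > 0"
  shows "(\<Sum>i\<in>UNIV. (\<Sum>s\<in>UNIV. prod_weight \<delta> v s * \<psi> i s * w s)\<^sup>2 / Q)
           \<le> 8 * \<delta>\<^sup>2 / (1 - \<delta>\<^sup>2)\<^sup>2 * (- Q * ln Q)"
proof -
  define \<tau> where "\<tau> = 2 * \<delta>\<^sup>2 / (1 - \<delta>\<^sup>2)\<^sup>2"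
  have "\<delta>\<^sup>2 < 1" using \<delta> by (simp add: abs_square_less_1)
  then have \<tau>: "\<tau> > 0" using \<delta> by (simp add: \<tau>_def)
  \<comment> \<open>The conditional mean of the score given the message; \<open>w s\<close> is the
    probability of sending it on \<open>s\<close>.\<close>
  define m where "m i = (\<Sum>s\<in>UNIV. prod_weight \<delta> v s * \<psi> i s * w s) / Q" for i
  define \<theta> where "\<theta> i = m i / (2 * \<tau>)" for i
  define N where "N = (\<Sum>i\<in>UNIV. (m i)\<^sup>2)"
  define X where "X s = (\<Sum>i\<in>UNIV. \<theta> i * \<psi> i s)" for s
  define c where "c = (\<Sum>i\<in>UNIV. \<theta> i * m i)"
  have EX: "(\<Sum>s\<in>UNIV. prod_weight \<delta> v s * w s * X s) = Q * c"
  proof -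
    have "(\<Sum>s\<in>UNIV. prod_weight \<delta> v s * w s * X s)
        = (\<Sum>i\<in>UNIV. \<Sum>s\<in>UNIV. prod_weight \<delta> v s * w s * (\<theta> i * \<psi> i s))"
      unfolding X_def sum_distrib_left by (rule sum.swap)
    also have "\<dots> = (\<Sum>i\<in>UNIV. \<theta> i * (Q * m i))"
    proof (intro sum.cong refl)
      fix i
      have "Q * m i = (\<Sum>s\<in>UNIV. prod_weight \<delta> v s * \<psi> i s * w s)"
        using Q(2) by (simp add: m_def)
      then show "(\<Sum>s\<in>UNIV. prod_weight \<delta> v s * w s * (\<theta> i * \<psi> i s)) = \<theta> i * (Q * m i)"
        by (simp add: sum_distrib_left mult_ac)
    qed
    finally show ?thesis by (simp add: c_def sum_distrib_left mult_ac)
  qed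
  \<comment> \<open>Given the message, \<open>X\<close> has mean \<open>c\<close>, so the linear
    term vanishes. Passing to the exponential and then dropping \<open>w s \<le> 1\<close> leaves a
    moment generating function under the product law, which factorizes.\<close>
  have "Q = (\<Sum>s\<in>UNIV. prod_weight \<delta> v s * w s * (1 + (X s - c)))"
    using EX by (simp add: algebra_simps sum.distrib sum_subtractf Q(1) sum_distrib_left)
  also have "\<dots> \<le> (\<Sum>s\<in>UNIV. prod_weight \<delta> v s * w s * exp (X s - c))"
    using \<delta> w by (intro sum_mono mult_left_mono exp_ge_add_one_self mult_nonneg_nonneg
        prod_weight_nonneg) auto
  also have "\<dots> \<le> (\<Sum>s\<in>UNIV. prod_weight \<delta> v s * exp (X s - c))"
  proof (intro sum_mono mult_right_mono)
    fix s show "prod_weight \<delta> v s * w s \<le> prod_weight \<delta> v s"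
      using \<delta> w prod_weight_nonneg[of \<delta> v s] by (simp add: mult_left_le)
  qed simp
  also have "\<dots> = exp (- c) * (\<Sum>s\<in>UNIV. \<Prod>i\<in>UNIV.
      (1 + \<delta> * (sgb (v i) * sgb (s i))) / 2 * exp (\<theta> i * score \<delta> (sgb (v i) * sgb (s i))))"
    unfolding sum_distrib_left
  proof (intro sum.cong refl)
    fix s
    have "exp (X s - c) = exp (- c) * (\<Prod>i\<in>UNIV. exp (\<theta> i * score \<delta> (sgb (v i) * sgb (s i))))"
      by (simp add: X_def \<psi>_def exp_diff exp_minus exp_sum divide_inverse)
    then show "prod_weight \<delta> v s * exp (X s - c) = exp (- c) * (\<Prod>i\<in>UNIV.
        (1 + \<delta> * (sgb (v i) * sgb (s i))) / 2 * exp (\<theta> i * score \<delta> (sgb (v i) * sgb (s i))))"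
      by (simp only: prod.distrib prod_weight_def mult.left_commute)
  qed
  also have "\<dots> \<le> exp (- c) * (\<Prod>i\<in>(UNIV :: 'n set). exp (\<tau> * (\<theta> i)\<^sup>2))"
  proof (intro mult_left_mono)
    have "(\<Sum>s\<in>UNIV. \<Prod>i\<in>UNIV. (1 + \<delta> * (sgb (v i) * sgb (s i))) / 2
            * exp (\<theta> i * score \<delta> (sgb (v i) * sgb (s i))))
        = (\<Prod>i\<in>UNIV. (1 + \<delta> * (sgb (v i) * sgb True)) / 2 * exp (\<theta> i * score \<delta> (sgb (v i) * sgb True))
            + (1 + \<delta> * (sgb (v i) * sgb False)) / 2 * exp (\<theta> i * score \<delta> (sgb (v i) * sgb False)))"
      by (rule sum_prod_bool_fun)
    also have "\<dots> \<le> (\<Prod>i\<in>UNIV. exp (\<tau> * (\<theta> i)\<^sup>2))"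
    proof (intro prod_mono conjI)
      fix i :: 'n
      show "(1 + \<delta> * (sgb (v i) * sgb True)) / 2 * exp (\<theta> i * score \<delta> (sgb (v i) * sgb True))
            + (1 + \<delta> * (sgb (v i) * sgb False)) / 2 * exp (\<theta> i * score \<delta> (sgb (v i) * sgb False))
          \<le> exp (\<tau> * (\<theta> i)\<^sup>2)"
        using score_mgf[of \<delta> "\<theta> i"] \<delta> by (cases "v i") (simp_all add: \<tau>_def add.commute)
    qed (use \<delta> in \<open>auto intro!: add_nonneg_nonneg mult_nonneg_nonneg\<close>)
    finally show "(\<Sum>s\<in>UNIV. \<Prod>i\<in>UNIV. (1 + \<delta> * (sgb (v i) * sgb (s i))) / 2
            * exp (\<theta> i * score \<delta> (sgb (v i) * sgb (s i)))) \<le> (\<Prod>i\<in>UNIV. exp (\<tau> * (\<theta> i)\<^sup>2))" .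
  qed simp
  also have "\<dots> = exp (\<tau> * (\<Sum>i\<in>UNIV. (\<theta> i)\<^sup>2) - c)"
    by (simp add: exp_sum exp_diff exp_minus sum_distrib_left field_simps)
  \<comment> \<open>The chosen \<open>\<theta>\<close> minimizes this quadratic exponent.\<close>
  also have "\<tau> * (\<Sum>i\<in>UNIV. (\<theta> i)\<^sup>2) - c = - N / (4 * \<tau>)"
  proof -
    have "(\<Sum>i\<in>UNIV. (\<theta> i)\<^sup>2) = N / (2 * \<tau>)\<^sup>2" "c = N / (2 * \<tau>)"
      by (simp_all add: N_def c_def \<theta>_def power_divide sum_divide_distrib power2_eq_square)
    then show ?thesis using \<tau> by (simp add: field_simps power2_eq_square)
  qed
  finally have "ln Q \<le> - N / (4 * \<tau>)"
    using Q(2) by (metis ln_exp ln_le_cancel_iff exp_gt_zero)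
  then have "N \<le> 4 * \<tau> * (- ln Q)"
    using \<tau> by (simp add: field_simps)
  then have "Q * N \<le> Q * (4 * \<tau> * (- ln Q))"
    using Q(2) by (intro mult_left_mono) auto
  moreover have "(\<Sum>i\<in>UNIV. (\<Sum>s\<in>UNIV. prod_weight \<delta> v s * \<psi> i s * w s)\<^sup>2 / Q) = Q * N"
    using Q(2) unfolding N_def m_def sum_distrib_left
    by (intro sum.cong refl) (simp add: power_divide power2_eq_square)
  ultimately show ?thesis by (simp add: \<tau>_def mult_ac)
qed

text \<open>Nonnegativity of the divergence from the uniform law, proved termwise; the corrections
  \<open>1 / real (card \<Omega>) - Q y\<close> sum to zero.\<close>

lemma entropy_le_ln_card:
  fixes Q :: "'y \<Rightarrow> real"
  assumes "finite \<Omega>" and Q: "\<And>y. y \<in> \<Omega> \<Longrightarrow> 0 \<le> Q y" "(\<Sum>y\<in>\<Omega>. Q y) = 1"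
  shows "(\<Sum>y\<in>\<Omega>. - Q y * ln (Q y)) \<le> ln (real (card \<Omega>))"
proof -
  have "\<Omega> \<noteq> {}" using Q by auto
  then have N: "real (card \<Omega>) > 0" using assms(1) by (simp add: card_gt_0_iff)
  have "- Q y * ln (Q y) \<le> Q y * ln (real (card \<Omega>)) + (1 / real (card \<Omega>) - Q y)" if "y \<in> \<Omega>" for y
  proof (cases "Q y = 0")
    case False
    then have pos: "Q y > 0" using Q(1)[OF that] by simp
    have "ln (1 / (real (card \<Omega>) * Q y)) \<le> 1 / (real (card \<Omega>) * Q y) - 1"
      using N pos by (intro ln_le_minus_one) simp
    then have "Q y * ln (1 / (real (card \<Omega>) * Q y)) \<le> Q y * (1 / (real (card \<Omega>) * Q y) - 1)"
      using pos by (intro mult_left_mono) auto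
    then show ?thesis using N pos by (simp add: ln_div ln_mult algebra_simps)
  qed simp
  then have "(\<Sum>y\<in>\<Omega>. - Q y * ln (Q y))
      \<le> (\<Sum>y\<in>\<Omega>. Q y * ln (real (card \<Omega>)) + (1 / real (card \<Omega>) - Q y))"
    by (rule sum_mono)
  also have "\<dots> = ln (real (card \<Omega>))"
    using N by (simp add: sum.distrib sum_subtractf Q(2) flip: sum_distrib_right)
  finally show ?thesis .
qed

text \<open>Two estimates of the same sum: bounding the score pointwise gives the dimension, while
  the level-1 inequality and the entropy bound give \<open>r\<close>. The constant 8 covers both for
  \<open>\<delta> \<le> 1 / 5\<close>: \<open>25 / 4 \<le> 8\<close> in the first,
  \<open>ln 2 / (1 - \<delta>\<^sup>2)\<^sup>2 \<le> 1\<close> in the second.\<close>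

lemma prod_weight_info:
  fixes v :: "'n::finite \<Rightarrow> bool" and w :: "bool list \<Rightarrow> ('n \<Rightarrow> bool) \<Rightarrow> real"
  assumes \<delta>: "0 < \<delta>" "\<delta> \<le> 1 / 5"
    and w0: "\<And>y s. 0 \<le> w y s" and w1: "\<And>s. (\<Sum>y | length y = r. w y s) = 1"
  shows "(\<Sum>i\<in>UNIV. \<Sum>y | length y = r.
           ((\<Sum>s\<in>UNIV. prod_weight \<delta> v s * w y s) - (\<Sum>s\<in>UNIV. prod_weight \<delta> (flip i v) s * w y s))\<^sup>2
             / (\<Sum>s\<in>UNIV. prod_weight \<delta> v s * w y s))
         \<le> 8 * \<delta>\<^sup>2 * min (real CARD('n)) (real r)"
proof -
  let ?\<Omega> = "{y :: bool list. length y = r}"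
  have fin: "finite ?\<Omega>" and card: "card ?\<Omega> = 2 ^ r"
    using finite_lists_length_eq[of "UNIV :: bool set" r] card_lists_length_eq[of "UNIV :: bool set" r]
    by simp_all
  have \<delta>1: "0 \<le> \<delta>" "\<delta> < 1" using \<delta> by auto
  define Q where "Q y = (\<Sum>s\<in>UNIV. prod_weight \<delta> v s * w y s)" for y
  define \<psi> where "\<psi> i s = score \<delta> (sgb (v i) * sgb (s i))" for i s
  define E where "E i y = (\<Sum>s\<in>UNIV. prod_weight \<delta> v s * \<psi> i s * w y s)" for i y
  have w_le: "w y s \<le> 1" if "y \<in> ?\<Omega>" for y s
    using member_le_sum[OF that, of "\<lambda>y. w y s"] w0 w1 fin by simp
  have Q0: "0 \<le> Q y" for y
    unfolding Q_def using \<delta>1 w0 by (intro sum_nonneg mult_nonneg_nonneg prod_weight_nonneg)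
  have Q1: "(\<Sum>y\<in>?\<Omega>. Q y) = 1"
    unfolding Q_def by (subst sum.swap) (simp add: w1 sum_prod_weight flip: sum_distrib_left)
  have diff: "Q y - (\<Sum>s\<in>UNIV. prod_weight \<delta> (flip i v) s * w y s) = E i y" for i y
    unfolding Q_def E_def \<psi>_def prod_weight_diff[OF \<delta>1, symmetric]
    by (simp add: algebra_simps sum_subtractf)
  have abs_score: "\<bar>\<psi> i s\<bar> \<le> 5 / 2 * \<delta>" for i s
  proof -
    have "\<bar>\<psi> i s\<bar> \<le> 2 * \<delta> / (4 / 5)"
      unfolding \<psi>_def score_def abs_divide using \<delta> by (intro frac_le) auto
    then show ?thesis by simp
  qed
  have "(\<Sum>i\<in>UNIV. \<Sum>y\<in>?\<Omega>. (E i y)\<^sup>2 / Q y) \<le> 8 * \<delta>\<^sup>2 * real CARD('n)"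
  proof -
    have E_le: "(E i y)\<^sup>2 / Q y \<le> (5 / 2 * \<delta>)\<^sup>2 * Q y" for i y
    proof (cases "Q y = 0")
      case False
      then have pos: "Q y > 0" using Q0[of y] by simp
      have "\<bar>E i y\<bar> \<le> (\<Sum>s\<in>UNIV. \<bar>prod_weight \<delta> v s * \<psi> i s * w y s\<bar>)"
        unfolding E_def by (rule sum_abs)
      also have "\<dots> \<le> (\<Sum>s\<in>UNIV. 5 / 2 * \<delta> * (prod_weight \<delta> v s * w y s))"
      proof (intro sum_mono)
        fix s
        have "\<bar>prod_weight \<delta> v s * \<psi> i s * w y s\<bar> = \<bar>\<psi> i s\<bar> * (prod_weight \<delta> v s * w y s)"
          using w0 prod_weight_nonneg[OF \<delta>1, of v s] by (simp add: abs_mult)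
        also have "\<dots> \<le> 5 / 2 * \<delta> * (prod_weight \<delta> v s * w y s)"
          using w0 prod_weight_nonneg[OF \<delta>1, of v s] by (intro mult_right_mono abs_score) auto
        finally show "\<bar>prod_weight \<delta> v s * \<psi> i s * w y s\<bar> \<le> 5 / 2 * \<delta> * (prod_weight \<delta> v s * w y s)" .
      qed
      also have "\<dots> = 5 / 2 * \<delta> * Q y" by (simp add: Q_def sum_distrib_left)
      finally have "(E i y)\<^sup>2 \<le> (5 / 2 * \<delta> * Q y)\<^sup>2"
        using \<delta> Q0[of y] by (subst abs_le_square_iff[symmetric]) simp
      then show ?thesis using pos by (simp add: field_simps power2_eq_square)
    qed simp
    have "(\<Sum>i\<in>UNIV. \<Sum>y\<in>?\<Omega>. (E i y)\<^sup>2 / Q y) \<le> (\<Sum>i\<in>(UNIV :: 'n set). \<Sum>y\<in>?\<Omega>. (5 / 2 * \<delta>)\<^sup>2 * Q y)"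
      by (intro sum_mono E_le)
    also have "\<dots> = (25 / 4 * \<delta>\<^sup>2) * real CARD('n)"
      unfolding sum_distrib_left[symmetric] Q1 by (simp add: power2_eq_square)
    also have "\<dots> \<le> 8 * \<delta>\<^sup>2 * real CARD('n)"
      by (intro mult_right_mono) auto
    finally show ?thesis .
  qed
  moreover have "(\<Sum>i\<in>UNIV. \<Sum>y\<in>?\<Omega>. (E i y)\<^sup>2 / Q y) \<le> 8 * \<delta>\<^sup>2 * real r"
  proof -
    have "(\<Sum>i\<in>UNIV. (E i y)\<^sup>2 / Q y) \<le> 8 * \<delta>\<^sup>2 / (1 - \<delta>\<^sup>2)\<^sup>2 * (- Q y * ln (Q y))" if "y \<in> ?\<Omega>" for y
    proof (cases "Q y = 0")
      case False
      then have "Q y > 0" using Q0[of y] by simp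
      then show ?thesis unfolding E_def \<psi>_def
        using \<delta> \<delta>1 w0 w_le[OF that] by (intro prod_weight_level_one) (auto simp: Q_def)
    qed simp
    then have "(\<Sum>i\<in>UNIV. \<Sum>y\<in>?\<Omega>. (E i y)\<^sup>2 / Q y)
        \<le> (\<Sum>y\<in>?\<Omega>. 8 * \<delta>\<^sup>2 / (1 - \<delta>\<^sup>2)\<^sup>2 * (- Q y * ln (Q y)))"
      by (subst sum.swap) (rule sum_mono)
    also have "\<dots> = 8 * \<delta>\<^sup>2 / (1 - \<delta>\<^sup>2)\<^sup>2 * (\<Sum>y\<in>?\<Omega>. - Q y * ln (Q y))"
      by (rule sum_distrib_left[symmetric])
    also have "\<dots> \<le> 8 * \<delta>\<^sup>2 / (1 - \<delta>\<^sup>2)\<^sup>2 * ln (real (card ?\<Omega>))"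
      using Q0 Q1 by (intro mult_left_mono entropy_le_ln_card fin) auto
    also have "\<dots> = 8 * \<delta>\<^sup>2 * (ln 2 / (1 - \<delta>\<^sup>2)\<^sup>2) * real r"
      unfolding card by (simp add: ln_realpow)
    also have "\<dots> \<le> 8 * \<delta>\<^sup>2 * 1 * real r"
    proof (intro mult_right_mono mult_left_mono)
      have "\<delta>\<^sup>2 \<le> (1 / 5)\<^sup>2" using \<delta> by (intro power_mono) auto
      then have "(24 / 25)\<^sup>2 \<le> (1 - \<delta>\<^sup>2)\<^sup>2" by (intro power_mono) (auto simp: power2_eq_square)
      then show "ln 2 / (1 - \<delta>\<^sup>2)\<^sup>2 \<le> 1"
        using ln2_le_25_over_36 by (simp add: power2_eq_square divide_le_eq_1)
    qed auto
    finally show ?thesis by simp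
  qed
  ultimately show ?thesis unfolding Q_def[symmetric] diff by (auto simp: min_def)
qed

section \<open>The two lower bounds\<close>

lemma conj_exp_cases:
  assumes "p \<ge> 2"
  obtains q where "conj_exp p = ereal q" "q \<ge> 1" "1 / q = 1 - inv_exp p"
proof (cases p)
  case (real p')
  then have "p' \<ge> 2" using assms by simp
  then show ?thesis using real
    by (intro that[of "p' / (p' - 1)"]) (auto simp: conj_exp_def inv_exp_def field_simps)
next
  case PInf
  then show ?thesis by (intro that[of 1]) (auto simp: conj_exp_def inv_exp_def)
qed (use assms in auto)

lemma lpnorm_ereal: "lpnorm (ereal q) x = (\<Sum>i\<in>UNIV. \<bar>x $ i\<bar> powr q) powr (1 / q)"
  by (simp add: lpnorm_def)

lemma lpnorm_axis:
  assumes "q \<ge> 1"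
  shows "lpnorm (ereal q) (axis i B :: real^'n) = \<bar>B\<bar>"
proof -
  have "(\<Sum>j\<in>UNIV. \<bar>axis i B $ j\<bar> powr q) = (\<Sum>j\<in>(UNIV :: 'n set). if j = i then \<bar>B\<bar> powr q else 0)"
    by (intro sum.cong) (auto simp: axis_def)
  then show ?thesis using assms by (simp add: lpnorm_ereal powr_powr)
qed

lemma lpnorm_sign_vec:
  assumes "q \<ge> 1"
  shows "lpnorm (ereal q) (sign_vec b v :: real^'n) = real CARD('n) powr (1 / q) * \<bar>b\<bar>"
proof -
  have "(\<Sum>i\<in>UNIV. \<bar>sign_vec b v $ i\<bar> powr q) = real CARD('n) * \<bar>b\<bar> powr q"
  proof -
    have "\<bar>c * sgb t\<bar> = \<bar>c\<bar>" for c t by simp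
    then show ?thesis unfolding sign_vec_nth by simp
  qed
  then show ?thesis using assms by (simp add: lpnorm_ereal powr_mult powr_powr)
qed

text \<open>The half-side \<open>a\<close> is chosen so that the diagonal, of p-norm
  \<open>2 * a * d powr inv_exp p\<close> with \<open>d = CARD('n)\<close>, has length exactly
  \<open>D\<close>.\<close>

lemma cube_in_diam_sets:
  assumes "p \<ge> 2" "0 \<le> D" and a: "a = D / 2 * real CARD('n) powr (- inv_exp p)"
  shows "(cube a :: (real^'n) set) \<in> diam_sets p D"
proof -
  have "0 \<le> a" using \<open>0 \<le> D\<close> unfolding a by (intro mult_nonneg_nonneg) auto
  then have ne: "(0 :: real^'n) \<in> cube a" by (simp add: cube_def)
  have "lpnorm p (x - y) \<le> D" if "x \<in> cube a" "y \<in> cube a" for x y :: "real^'n"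
  proof -
    have le: "\<bar>(x - y) $ i\<bar> \<le> 2 * a" for i
      using that unfolding cube_def by (auto dest!: spec[of _ i])
    show ?thesis
    proof (cases p)
      case PInf
      then have "2 * a = D" using a by (simp add: inv_exp_def)
      then show ?thesis using le PInf by (auto simp: lpnorm_def)
    next
      case (real p')
      then have p': "p' \<ge> 2" using assms by simp
      have "(\<Sum>i\<in>UNIV. \<bar>(x - y) $ i\<bar> powr p') \<le> (\<Sum>i\<in>(UNIV :: 'n set). (2 * a) powr p')"
        using p' by (intro sum_mono powr_mono2 le) auto
      then have "lpnorm p (x - y) \<le> (real CARD('n) * (2 * a) powr p') powr (1 / p')"
        unfolding real lpnorm_ereal using p' by (intro powr_mono2) (auto intro: sum_nonneg)
      also have "\<dots> = real CARD('n) powr (1 / p') * (2 * a)"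
        using p' \<open>0 \<le> a\<close> by (simp add: powr_mult powr_powr)
      also have "\<dots> = D"
        using p' by (simp add: a real inv_exp_def powr_minus)
      finally show ?thesis .
    qed (use assms in auto)
  qed
  then show ?thesis using ne by (auto simp: diam_sets_def)
qed

section \<open>Admissible biases and the final constants\<close>

lemma bias_ratio_le:
  fixes \<delta> :: real
  assumes "0 \<le> \<delta>" "\<delta> \<le> 1 / 5"
  shows "(1 + \<delta>) / (1 - \<delta>) \<le> 3 / 2"
  using assms by (simp add: field_simps)

text \<open>A multiple of a unit vector has the same q-norm for every \<open>q\<close>, so answers
  of size \<open>B\<close> are allowed. The 30 is \<open>4 * (3 / 2) * 5\<close>: the target
  \<open>d / 4\<close>, the ratio bound, and \<open>4 / (1 - \<delta>) \<le> 5\<close>.\<close>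

lemma minimax_err_cube_coord_ge:
  fixes p :: ereal and D B \<delta> :: real
  defines "a \<equiv> D / 2 * real CARD('n) powr (- inv_exp p)"
  assumes p: "p \<ge> 2" and "0 \<le> D" "0 \<le> B" and \<delta>: "0 \<le> \<delta>" "\<delta> \<le> 1 / 5"
    and T: "30 * \<delta>\<^sup>2 * real T * min (real CARD('n)) (2 ^ r) \<le> (real CARD('n))\<^sup>2"
  shows "minimax_err (cube a :: (real^'n) set) p B T r \<ge> ereal (\<delta> * B * a / 2)"
proof -
  have \<delta>1: "\<delta> < 1" using \<delta> by simp
  obtain q where q: "conj_exp p = ereal q" "q \<ge> 1" using conj_exp_cases[OF p] by metis
  define d where "d = real CARD('n)"
  have d: "d > 0" by (simp add: d_def)
  define P where "P v = embed_pmf (coord_weight \<delta> v)" for v :: "'n \<Rightarrow> bool"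
  have P: "pmf (P v) z = coord_weight \<delta> v z" for v z
    unfolding P_def using \<delta> \<delta>1 by (intro pmf_embed_finite coord_weight_nonneg sum_coord_weight)
  have card: "card {y :: bool list. length y = r} = 2 ^ r" "finite {y :: bool list. length y = r}"
    using card_lists_length_eq[of "UNIV :: bool set" r] finite_lists_length_eq[of "UNIV :: bool set" r]
    by simp_all
  let ?K = "4 * \<delta>\<^sup>2 * min (2 ^ r) d / (d * (1 - \<delta>))"
  have "minimax_err (cube a :: (real^'n) set) p B T r \<ge> ereal (\<delta> * B / d * a * d / 2)"
    unfolding d_def
  proof (rule minimax_err_cube_ge[where P = P and G = "\<lambda>z. axis (fst z) (sgb (snd z) * B)"
        and \<rho> = "(1 + \<delta>) / (1 - \<delta>)" and K = ?K])
    show "(lpnorm (conj_exp p) (axis (fst z) (sgb (snd z) * B) :: real^'n))\<^sup>2 \<le> B\<^sup>2" for z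
      unfolding q(1) lpnorm_axis[OF q(2)] by simp
    show "(\<Sum>z\<in>UNIV. pmf (P v) z *\<^sub>R axis (fst z) (sgb (snd z) * B)) = sign_vec (\<delta> * B / real CARD('n)) v" for v
      unfolding P by (rule mean_coord_weight)
    show "pmf (P v) z \<le> (1 + \<delta>) / (1 - \<delta>) * pmf (P (flip i v)) z" for v i z
      unfolding P using \<delta> \<delta>1 by (intro coord_weight_ratio)
    show "(\<Sum>i\<in>UNIV. \<Sum>y | length y = r.
           ((\<Sum>z\<in>UNIV. pmf (P v) z * w y z) - (\<Sum>z\<in>UNIV. pmf (P (flip i v)) z * w y z))\<^sup>2
             / (\<Sum>z\<in>UNIV. pmf (P v) z * w y z)) \<le> ?K"
      if "\<And>y z. 0 \<le> w y z" "\<And>z. (\<Sum>y | length y = r. w y z) = 1" for v and w :: "bool list \<Rightarrow> _"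
      using coord_weight_info[of \<delta> "{y. length y = r}" w v] that \<delta> \<delta>1 card
      unfolding P d_def by simp
    have "(1 + \<delta>) / (1 - \<delta>) * real T * ?K \<le> 3 / 2 * real T * (5 * \<delta>\<^sup>2 * min (2 ^ r) d / d)"
    proof (intro mult_mono bias_ratio_le \<delta>)
      have "4 * \<delta>\<^sup>2 * min (2 ^ r) d / (d * (1 - \<delta>)) \<le> 4 * \<delta>\<^sup>2 * min (2 ^ r) d / (d * (4 / 5))"
        using \<delta> d by (intro divide_left_mono mult_left_mono) auto
      then show "?K \<le> 5 * \<delta>\<^sup>2 * min (2 ^ r) d / d" by simp
    qed (use \<delta> \<delta>1 d in auto)
    also have "\<dots> = 30 * \<delta>\<^sup>2 * real T * min d (2 ^ r) / (4 * d)"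
      by (simp add: min.commute)
    also have "\<dots> \<le> d\<^sup>2 / (4 * d)"
      using T d unfolding d_def by (intro divide_right_mono) auto
    also have "\<dots> = d / 4"
      using d by (simp add: power2_eq_square)
    finally show "(1 + \<delta>) / (1 - \<delta>) * real T * ?K \<le> real CARD('n) / 4"
      by (simp add: d_def)
  qed (use assms d in \<open>auto simp: a_def\<close>)
  then show ?thesis using d by simp
qed

text \<open>All coordinates are sent at once, so each is scaled down to \<open>b\<close> to keep
  q-norm \<open>B\<close>. The 48 is \<open>4 * (3 / 2) * 8\<close>.\<close>

lemma minimax_err_cube_prod_ge:
  fixes p :: ereal and D B \<delta> :: real
  defines "a \<equiv> D / 2 * real CARD('n) powr (- inv_exp p)"
  assumes p: "p \<ge> 2" and "0 \<le> D" "0 \<le> B" and \<delta>: "0 < \<delta>" "\<delta> \<le> 1 / 5"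
    and T: "48 * \<delta>\<^sup>2 * real T * min (real CARD('n)) (real r) \<le> real CARD('n)"
  shows "minimax_err (cube a :: (real^'n) set) p B T r \<ge> ereal (\<delta> * B * D / 4)"
proof -
  have \<delta>1: "0 \<le> \<delta>" "\<delta> < 1" using \<delta> by simp_all
  obtain q where q: "conj_exp p = ereal q" "q \<ge> 1" "1 / q = 1 - inv_exp p"
    using conj_exp_cases[OF p] by metis
  define d where "d = real CARD('n)"
  have d: "d > 0" by (simp add: d_def)
  define b where "b = B * d powr (- (1 / q))"
  define P where "P v = embed_pmf (prod_weight \<delta> v)" for v :: "'n \<Rightarrow> bool"
  have P: "pmf (P v) z = prod_weight \<delta> v z" for v z
    unfolding P_def using \<delta>1 by (intro pmf_embed_finite prod_weight_nonneg sum_prod_weight)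
  let ?K = "8 * \<delta>\<^sup>2 * min d (real r)"
  have "minimax_err (cube a :: (real^'n) set) p B T r \<ge> ereal (\<delta> * b * a * d / 2)"
    unfolding d_def
  proof (rule minimax_err_cube_ge[where P = P and G = "sign_vec b" and \<rho> = "(1 + \<delta>) / (1 - \<delta>)" and K = ?K])
    have "d powr (1 / q) * \<bar>b\<bar> = B"
      using d \<open>0 \<le> B\<close> by (simp add: b_def abs_mult powr_minus)
    then show "(lpnorm (conj_exp p) (sign_vec b s :: real^'n))\<^sup>2 \<le> B\<^sup>2" for s
      unfolding q(1) lpnorm_sign_vec[OF q(2)] d_def by simp
    show "(\<Sum>s\<in>UNIV. pmf (P v) s *\<^sub>R sign_vec b s) = sign_vec (\<delta> * b) v" for v
      unfolding P by (rule mean_prod_weight)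
    show "pmf (P v) s \<le> (1 + \<delta>) / (1 - \<delta>) * pmf (P (flip i v)) s" for v i s
      unfolding P using \<delta>1 by (intro prod_weight_ratio)
    show "(\<Sum>i\<in>UNIV. \<Sum>y | length y = r.
           ((\<Sum>s\<in>UNIV. pmf (P v) s * w y s) - (\<Sum>s\<in>UNIV. pmf (P (flip i v)) s * w y s))\<^sup>2
             / (\<Sum>s\<in>UNIV. pmf (P v) s * w y s)) \<le> ?K"
      if "\<And>y s. 0 \<le> w y s" "\<And>s. (\<Sum>y | length y = r. w y s) = 1" for v and w :: "bool list \<Rightarrow> _"
      unfolding P d_def using that by (intro prod_weight_info \<delta>)
    have "(1 + \<delta>) / (1 - \<delta>) * real T * ?K \<le> 3 / 2 * real T * ?K"
      using \<delta>1 \<delta> d by (intro mult_right_mono bias_ratio_le) auto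
    also have "\<dots> \<le> d / 4"
      using T by (simp add: d_def mult_ac)
    finally show "(1 + \<delta>) / (1 - \<delta>) * real T * ?K \<le> real CARD('n) / 4"
      by (simp add: d_def)
  qed (use assms \<delta>1 in \<open>auto simp: a_def b_def\<close>)
  also have "\<delta> * b * a * d / 2 = \<delta> * B * D / 4 * (d powr (- (1 / q)) * d powr (- inv_exp p) * d powr 1)"
    using d by (simp add: b_def a_def d_def)
  \<comment> \<open>Conjugacy of the exponents cancels the dimension, hence the absence of a power
    of \<open>d\<close> in front of the second bound.\<close>
  also have "d powr (- (1 / q)) * d powr (- inv_exp p) * d powr 1 = 1"
    unfolding powr_add[symmetric] q(3) using d by simp
  finally show ?thesis by simp
qed

theorem theorem5:
  fixes p :: ereal and D B :: real and r T :: nat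
  assumes "p \<ge> 2" and "D > 0" and "B > 0" and "r \<ge> 1"
    and "real T \<ge> 1/4 * (real CARD('n))\<^sup>2 / min (2 ^ r) (real CARD('n))"
  shows "ereal (max
            (1 / (12 * sqrt 58) * D * B * real CARD('n) powr (1/2 - inv_exp p) / sqrt (real T)
               * sqrt (real CARD('n) / min (real CARD('n)) (2 ^ r)))
            (1 / (12 * sqrt 58) * D * B / sqrt (real T)
               * sqrt (real CARD('n) / min (real CARD('n)) (real r))))
         \<le> (SUP X \<in> (diam_sets p D :: (real^'n) set set). minimax_err X p B T r)"
proof -
  define d where "d = real CARD('n)"
  define m where "m = min d (2 ^ r)"
  define k where "k = min d (real r)"
  define a where "a = D / 2 * d powr (- inv_exp p)"
  have d: "d \<ge> 1" by (simp add: d_def)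
  have m: "m \<ge> 1" "m \<le> d" and k: "k \<ge> 1" "k \<le> d"
    using d \<open>r \<ge> 1\<close> by (simp_all add: m_def k_def)
  have T4: "d\<^sup>2 \<le> 4 * real T * m"
    using assms(5) m by (simp add: d_def m_def min.commute field_simps)
  have "real T > 0"
  proof (rule ccontr)
    assume "\<not> ?thesis"
    then show False using T4 d by simp
  qed
  \<comment> \<open>Both constructions reach the constant \<open>1 / 40\<close>: 1/10 from the
    choice of \<delta> and 1/4 from the reduction and the half-side.\<close>
  have const: "1 / (12 * sqrt 58) \<le> 1 / (40 :: real)"
  proof -
    have "(40 / 12)\<^sup>2 \<le> (58 :: real)" by (simp add: power2_eq_square)
    then have "40 / 12 \<le> sqrt (58 :: real)" by (rule real_le_rsqrt)
    then show ?thesis by (intro divide_left_mono) auto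
  qed
  have "ereal (1 / (12 * sqrt 58) * D * B * d powr (1/2 - inv_exp p) / sqrt (real T) * sqrt (d / m))
      \<le> minimax_err (cube a :: (real^'n) set) p B T r"
  proof -
    \<comment> \<open>The largest order that the information constraint permits. The lower bound on
      \<open>T\<close> is what makes it at most 1/5.\<close>
    define \<delta> where "\<delta> = d / (10 * sqrt (real T * m))"
    have sq: "\<delta>\<^sup>2 = d\<^sup>2 / (100 * (real T * m))"
      using m by (simp add: \<delta>_def power_divide power_mult_distrib)
    have "\<delta>\<^sup>2 \<le> (1 / 5)\<^sup>2"
      unfolding sq using T4 m \<open>real T > 0\<close> by (simp add: power2_eq_square field_simps)
    then have \<delta>: "0 \<le> \<delta>" "\<delta> \<le> 1 / 5"
      using d m by (auto simp: \<delta>_def intro: power2_le_imp_le)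
    have "30 * \<delta>\<^sup>2 * real T * m \<le> d\<^sup>2"
      unfolding sq using m \<open>real T > 0\<close> by (simp add: field_simps)
    then have bound: "ereal (\<delta> * B * a / 2) \<le> minimax_err (cube a :: (real^'n) set) p B T r"
      using minimax_err_cube_coord_ge[OF assms(1) _ _ \<delta>, where 'n = 'n, of D B T r] assms(2,3)
      by (simp add: a_def d_def m_def)
    have eq: "\<delta> * B * a / 2 = 1 / 40 * (D * B * d powr (1/2 - inv_exp p) / sqrt (real T) * sqrt (d / m))"
    proof -
      have "d powr (1/2 - inv_exp p) = sqrt d * d powr (- inv_exp p)"
        using d powr_add[of d "1 / 2" "- inv_exp p"] by (simp add: powr_half_sqrt)
      moreover have "sqrt d * sqrt d = d" using d by simp
      ultimately show ?thesis
        by (simp add: \<delta>_def a_def real_sqrt_mult real_sqrt_divide mult_ac)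
    qed
    have "1 / (12 * sqrt 58) * (D * B * d powr (1/2 - inv_exp p) / sqrt (real T) * sqrt (d / m))
        \<le> 1 / 40 * (D * B * d powr (1/2 - inv_exp p) / sqrt (real T) * sqrt (d / m))"
      using assms d m by (intro mult_right_mono const) auto
    then have "1 / (12 * sqrt 58) * D * B * d powr (1/2 - inv_exp p) / sqrt (real T) * sqrt (d / m) \<le> 1 / 40 * (D * B * d powr (1/2 - inv_exp p) / sqrt (real T) * sqrt (d / m))"
      by simp
    then have "ereal (1 / (12 * sqrt 58) * D * B * d powr (1/2 - inv_exp p) / sqrt (real T) * sqrt (d / m)) \<le> ereal (\<delta> * B * a / 2)"
      unfolding eq by (simp only: ereal_less_eq)
    then show ?thesis using bound by (rule order_trans)
  qed
  moreover have "ereal (1 / (12 * sqrt 58) * D * B / sqrt (real T) * sqrt (d / k))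
      \<le> minimax_err (cube a :: (real^'n) set) p B T r"
  proof -
    define \<delta> where "\<delta> = sqrt (d / (real T * k)) / 10"
    have sq: "\<delta>\<^sup>2 = d / (100 * (real T * k))"
      using k d by (simp add: \<delta>_def power_divide)
    \<comment> \<open>Transfers the assumption on \<open>T\<close>, stated for \<open>m\<close>, to
      the form \<open>d \<le> 4 * real T * k\<close> that this bias needs.\<close>
    have "m \<le> d * k"
      using m k d mult_mono[of m d 1 k] by simp
    have "d \<le> 4 * real T * k"
    proof -
      have "d * d \<le> 4 * real T * (d * k)"
        using T4 mult_left_mono[OF \<open>m \<le> d * k\<close>, of "4 * real T"] by (simp add: power2_eq_square)
      then show ?thesis using d by (simp add: mult_ac)
    qed
    then have "\<delta>\<^sup>2 \<le> (1 / 5)\<^sup>2"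
      unfolding sq using k \<open>real T > 0\<close> by (simp add: power2_eq_square field_simps)
    then have \<delta>: "0 < \<delta>" "\<delta> \<le> 1 / 5"
      using d k \<open>real T > 0\<close> by (auto simp: \<delta>_def intro: power2_le_imp_le)
    have "48 * \<delta>\<^sup>2 * real T * k \<le> d"
      unfolding sq using k d \<open>real T > 0\<close> by (simp add: field_simps)
    then have bound: "ereal (\<delta> * B * D / 4) \<le> minimax_err (cube a :: (real^'n) set) p B T r"
      using minimax_err_cube_prod_ge[OF assms(1) _ _ \<delta>, where 'n = 'n, of D B T r] assms(2,3)
      by (simp add: a_def d_def k_def)
    have eq: "\<delta> * B * D / 4 = 1 / 40 * (D * B / sqrt (real T) * sqrt (d / k))"
      by (simp add: \<delta>_def real_sqrt_mult real_sqrt_divide mult_ac)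
    have "1 / (12 * sqrt 58) * (D * B / sqrt (real T) * sqrt (d / k))
        \<le> 1 / 40 * (D * B / sqrt (real T) * sqrt (d / k))"
      using assms d k by (intro mult_right_mono const) auto
    then have "1 / (12 * sqrt 58) * D * B / sqrt (real T) * sqrt (d / k) \<le> 1 / 40 * (D * B / sqrt (real T) * sqrt (d / k))"
      by simp
    then have "ereal (1 / (12 * sqrt 58) * D * B / sqrt (real T) * sqrt (d / k)) \<le> ereal (\<delta> * B * D / 4)"
      unfolding eq by (simp only: ereal_less_eq)
    then show ?thesis using bound by (rule order_trans)
  qed
  \<comment> \<open>Both bounds hold on the same cube, so this single set yields their
    maximum.\<close>
  moreover have "(cube a :: (real^'n) set) \<in> diam_sets p D"
    using assms by (intro cube_in_diam_sets) (auto simp: a_def d_def)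
  ultimately show ?thesis
    unfolding d_def m_def k_def
    by (intro SUP_upper2[where i = "cube a"]) (auto simp: max_def)
qed

end
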